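(* Let $F^l$ be a submanifold of a Riemannian manifold $M^n$ and let $\xi$ be a vector field on $M^n$ along $F^l$. Then $\xi(F^l)$ is totally geodesic in $TM^n$ (with the Sasaki metric) if and only if both of the following hold: (a) $F^l$ is totally geodesic with respect to the $\xi$-connection $\stackrel{*}{\nabla}$; (b) for any vector fields $X,Y$ tangent to $F^l$, $$\bar\nabla_X\bar\nabla_Y\xi=\bar\nabla_{\stackrel{*}{\nabla}_XY}\,\xi+\tfrac12\bar R(X,Y)\xi .$$
   Context: All manifolds and vector fields are smooth; superscripts denote dimensions. $\bar g$, $\bar\nabla$ and $\bar R(X,Y)Z=\bar\nabla_X\bar\nabla_YZ-\bar\nabla_Y\bar\nabla_XZ-\bar\nabla_{[X,Y]}Z$ are the metric, Levi-Civita connection and curvature tensor of $M^n$. Let $\pi:TM^n\to M^n$ be the projection and $K:TTM^n\to TM^n$ the connection map, given in induced coordinates $(x^a,\xi^a)$ by $K(\tilde X^a\partial_{x^a}+\tilde X^{n+a}\partial_{\xi^a})=(\tilde X^{n+a}+\bar\Gamma^a_{bc}\xi^b\tilde X^c)\partial_{x^a}$. The Sasaki metric on $TM^n$ is $g_s(\tilde X,\tilde Y)=\bar g(\pi_*\tilde X,\pi_*\tilde Y)+\bar g(K\tilde X,K\tilde Y)$. A vector field on $M^n$ along $F$ is a smooth map $\xi:F\to TM^n$ with $\pi\circ\xi=\mathrm{Id}_F$ (not necessarily tangent to $F$); $\xi(F)$ is its image. The $\xi$-connection is $$\stackrel{*}{\nabla}_{X}Y=\bar\nabla_XY+\tfrac12\big[\bar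 R(\xi,\bar\nabla_X\xi)Y+\bar R(\xi,\bar\nabla_Y\xi)X\big],$$ a torsion-free affine connection on $M^n$ when $\xi$ is defined on $M^n$; for $X,Y$ tangent to $F^l$ the formula makes sense along $F^l$ when $\xi$ is only defined along $F^l$. "$F^l$ is totally geodesic with respect to $\stackrel{*}{\nabla}$" means $\stackrel{*}{\nabla}_XY$ is tangent to $F^l$ for all vector fields $X,Y$ tangent to $F^l$. In (b), $\bar\nabla_{\stackrel{*}{\nabla}_XY}\xi$ is understood when (a) holds, so that only derivatives of $\xi$ in directions tangent to $F^l$ occur. *)

theory Defs
  imports "HOL-Analysis.Analysis"
begin

section \<open>Smooth manifolds\<close>

text \<open>
  A manifold modelled on a Euclidean space is given by its atlas, a set of pairs (domain, map).
  The dimension is the dimension of the model type, the underlying point set is the union of the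
  chart domains, and the topology is the one induced by the charts. Values of chart maps outside
  their domains are irrelevant.
\<close>

type_synonym ('a, 'e) chart = "'a set \<times> ('a \<Rightarrow> 'e)"
type_synonym ('a, 'e) atlas = "('a, 'e) chart set"

primrec times_differentiable_on ::
  "nat \<Rightarrow> 'e::real_normed_vector set \<Rightarrow> ('e \<Rightarrow> 'd::real_normed_vector) \<Rightarrow> bool" where
  "times_differentiable_on 0 S f \<longleftrightarrow> continuous_on S f"
| "times_differentiable_on (Suc k) S f \<longleftrightarrow>
     (\<forall>x\<in>S. f differentiable (at x)) \<and>
     (\<forall>v. times_differentiable_on k S (\<lambda>x. frechet_derivative f (at x) v))"

text \<open>Infinite differentiability; only used for open \<open>S\<close>.\<close>

definition smooth_on ::
  "'e::real_normed_vector set \<Rightarrow> ('e \<Rightarrow> 'd::real_normed_vector) \<Rightarrow> bool" where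
  "smooth_on S f \<longleftrightarrow> (\<forall>k. times_differentiable_on k S f)"

definition chart_inv :: "('a, 'e) chart \<Rightarrow> 'e \<Rightarrow> 'a" where
  "chart_inv c = inv_into (fst c) (snd c)"

definition pts :: "('a, 'e) atlas \<Rightarrow> 'a set" where
  "pts A = (\<Union>c\<in>A. fst c)"

definition charts_at :: "('a, 'e) atlas \<Rightarrow> 'a \<Rightarrow> ('a, 'e) chart set" where
  "charts_at A p = {c \<in> A. p \<in> fst c}"

definition manifold_topology :: "('a, 'e::euclidean_space) atlas \<Rightarrow> 'a topology" where
  "manifold_topology A =
     topology (\<lambda>W. W \<subseteq> pts A \<and> (\<forall>c\<in>A. open (snd c ` (W \<inter> fst c))))"

definition smooth_manifold :: "('a, 'e::euclidean_space) atlas \<Rightarrow> bool" where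
  "smooth_manifold A \<longleftrightarrow>
     (\<forall>c\<in>A. inj_on (snd c) (fst c)) \<and>
     (\<forall>c\<in>A. \<forall>c'\<in>A. open (snd c ` (fst c \<inter> fst c')) \<and>
        smooth_on (snd c ` (fst c \<inter> fst c')) (snd c' \<circ> chart_inv c)) \<and>
     Hausdorff_space (manifold_topology A) \<and>
     second_countable (manifold_topology A)"

text \<open>The openness requirement expresses continuity of \<open>f\<close>.\<close>

definition smooth_map ::
  "('a, 'e::euclidean_space) atlas \<Rightarrow> ('b, 'd::euclidean_space) atlas \<Rightarrow> ('a \<Rightarrow> 'b) \<Rightarrow> bool" where
  "smooth_map A B f \<longleftrightarrow>
     f ` pts A \<subseteq> pts B \<and>
     (\<forall>c\<in>A. \<forall>c'\<in>B. open (snd c ` (fst c \<inter> f -` fst c')) \<and>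
        smooth_on (snd c ` (fst c \<inter> f -` fst c')) (snd c' \<circ> f \<circ> chart_inv c))"

section \<open>Tangent vectors\<close>

text \<open>
  A tangent vector is a pair of its base point and the family of its components in all charts
  around the base point, related by the Jacobians of the coordinate changes. The components with
  respect to all other indices are set to 0, so that equality of tangent vectors is equality of
  pairs.
\<close>

type_synonym ('a, 'e) tvec = "'a \<times> (('a, 'e) chart \<Rightarrow> 'e)"

definition tangent_space ::
  "('a, 'e::euclidean_space) atlas \<Rightarrow> 'a \<Rightarrow> ('a, 'e) tvec set" where
  "tangent_space A p =
     {w. fst w = p \<and>
         (\<forall>c\<in>charts_at A p. \<forall>c'\<in>charts_at A p.
            snd w c' = frechet_derivative (snd c' \<circ> chart_inv c) (at (snd c p)) (snd w c)) \<and>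
         (\<forall>c. c \<notin> charts_at A p \<longrightarrow> snd w c = 0)}"

definition tadd :: "('a, 'e::real_vector) tvec \<Rightarrow> ('a, 'e) tvec \<Rightarrow> ('a, 'e) tvec" where
  "tadd v w = (fst v, \<lambda>c. snd v c + snd w c)"

definition tscale :: "real \<Rightarrow> ('a, 'e::real_vector) tvec \<Rightarrow> ('a, 'e) tvec" where
  "tscale a v = (fst v, \<lambda>c. a *\<^sub>R snd v c)"

text \<open>The tangent vector at \<open>p\<close> whose component in the chart \<open>c\<close> is \<open>u\<close>.\<close>

definition tangent_vec ::
  "('a, 'e::euclidean_space) atlas \<Rightarrow> ('a, 'e) chart \<Rightarrow> 'a \<Rightarrow> 'e \<Rightarrow> ('a, 'e) tvec" where
  "tangent_vec A c p u =
     (p, \<lambda>c'. if c' \<in> charts_at A p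
              then frechet_derivative (snd c' \<circ> chart_inv c) (at (snd c p)) u else 0)"

text \<open>
  The derivative \<open>w h\<close> of a vector-valued function \<open>h\<close> in the direction of the tangent vector
  \<open>w\<close>; by the chain rule it does not depend on the chosen chart.
\<close>

definition dir_deriv ::
  "('a, 'e::euclidean_space) atlas \<Rightarrow> ('a \<Rightarrow> 'd::real_normed_vector) \<Rightarrow> ('a, 'e) tvec \<Rightarrow> 'd" where
  "dir_deriv A h w =
     (let c = (SOME c. c \<in> charts_at A (fst w))
      in frechet_derivative (h \<circ> chart_inv c) (at (snd c (fst w))) (snd w c))"

definition differential ::
  "('a, 'e::euclidean_space) atlas \<Rightarrow> ('b, 'd::euclidean_space) atlas \<Rightarrow> ('a \<Rightarrow> 'b)
     \<Rightarrow> ('a, 'e) tvec \<Rightarrow> ('b, 'd) tvec" where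
  "differential A B f w =
     (f (fst w), \<lambda>c'. if c' \<in> charts_at B (f (fst w)) then dir_deriv A (snd c' \<circ> f) w else 0)"

text \<open>
  The points of the tangent bundle are the tangent vectors; a chart \<open>x\<close> of the base induces the
  chart \<open>(x, \<xi>)\<close> of the bundle.
\<close>

definition induced_chart ::
  "('a, 'e::euclidean_space) atlas \<Rightarrow> ('a, 'e) chart \<Rightarrow> (('a, 'e) tvec, 'e \<times> 'e) chart" where
  "induced_chart A c =
     ((\<Union>p\<in>fst c. tangent_space A p), \<lambda>w. (snd c (fst w), snd w c))"

definition tangent_bundle ::
  "('a, 'e::euclidean_space) atlas \<Rightarrow> (('a, 'e) tvec, 'e \<times> 'e) atlas" where
  "tangent_bundle A = induced_chart A ` A"

section \<open>Submanifolds and vector fields\<close>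

text \<open>
  Submanifolds are subsets carrying a manifold structure of their own for which the inclusion is
  an immersion. Embedded submanifolds are the case where the topology is the subspace topology.
\<close>

definition submanifold ::
  "('a, 'd::euclidean_space) atlas \<Rightarrow> ('a, 'e::euclidean_space) atlas \<Rightarrow> bool" where
  "submanifold F M \<longleftrightarrow>
     smooth_manifold F \<and> smooth_map F M id \<and>
     (\<forall>p\<in>pts F. inj_on (differential F M id) (tangent_space F p))"

definition vector_field_along ::
  "('a, 'e::euclidean_space) atlas \<Rightarrow> ('a, 'd::euclidean_space) atlas \<Rightarrow> ('a \<Rightarrow> ('a, 'e) tvec) \<Rightarrow> bool"
  where
  "vector_field_along M F \<xi> \<longleftrightarrow>
     smooth_map F (tangent_bundle M) \<xi> \<and> (\<forall>p\<in>pts F. fst (\<xi> p) = p)"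

text \<open>
  Vector fields tangent to a submanifold \<open>F\<close> are the sections of the tangent bundle of \<open>F\<close>;
  \<open>push\<close> regards their values as tangent vectors of the ambient manifold, and \<open>pull\<close> is its
  inverse on vectors that are tangent to \<open>F\<close>.
\<close>

abbreviation tangent_field ::
  "('a, 'd::euclidean_space) atlas \<Rightarrow> ('a \<Rightarrow> ('a, 'd) tvec) \<Rightarrow> bool" where
  "tangent_field F \<equiv> vector_field_along F F"

abbreviation push ::
  "('a, 'd::euclidean_space) atlas \<Rightarrow> ('a, 'e::euclidean_space) atlas
     \<Rightarrow> ('a, 'd) tvec \<Rightarrow> ('a, 'e) tvec" where
  "push F M \<equiv> differential F M id"

definition pull ::
  "('a, 'd::euclidean_space) atlas \<Rightarrow> ('a, 'e::euclidean_space) atlas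
     \<Rightarrow> ('a, 'e) tvec \<Rightarrow> ('a, 'd) tvec" where
  "pull F M v = (THE w. w \<in> tangent_space F (fst v) \<and> push F M w = v)"

text \<open>
  The image of a vector field \<open>\<xi>\<close> along \<open>F\<close>, as a subset of the tangent bundle with the manifold
  structure transported from \<open>F\<close> by \<open>\<xi>\<close>; the inverse of \<open>\<xi>\<close> is the bundle projection \<open>fst\<close>.
\<close>

definition field_image ::
  "('a \<Rightarrow> ('a, 'e) tvec) \<Rightarrow> ('a, 'd) atlas \<Rightarrow> (('a, 'e) tvec, 'd) atlas" where
  "field_image \<xi> F = (\<lambda>c. (\<xi> ` fst c, snd c \<circ> fst)) ` F"

section \<open>Riemannian metrics, Levi-Civita connection, curvature\<close>

type_synonym ('a, 'e) metric = "('a, 'e) tvec \<Rightarrow> ('a, 'e) tvec \<Rightarrow> real"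

definition chart_metric ::
  "('a, 'e::euclidean_space) atlas \<Rightarrow> ('a, 'e) metric \<Rightarrow> ('a, 'e) chart \<Rightarrow> 'e \<Rightarrow> 'e \<Rightarrow> 'e \<Rightarrow> real"
  where
  "chart_metric A g c x u v =
     g (tangent_vec A c (chart_inv c x) u) (tangent_vec A c (chart_inv c x) v)"

definition riemannian_manifold ::
  "('a, 'e::euclidean_space) atlas \<Rightarrow> ('a, 'e) metric \<Rightarrow> bool" where
  "riemannian_manifold A g \<longleftrightarrow>
     smooth_manifold A \<and>
     (\<forall>p\<in>pts A.
        (\<forall>u\<in>tangent_space A p. \<forall>v\<in>tangent_space A p. g u v = g v u) \<and>
        (\<forall>u\<in>tangent_space A p. \<forall>v\<in>tangent_space A p. \<forall>w\<in>tangent_space A p.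
           g (tadd u v) w = g u w + g v w) \<and>
        (\<forall>a. \<forall>u\<in>tangent_space A p. \<forall>v\<in>tangent_space A p. g (tscale a u) v = a * g u v) \<and>
        (\<forall>u\<in>tangent_space A p. u \<noteq> (p, \<lambda>_. 0) \<longrightarrow> g u u > 0)) \<and>
     (\<forall>c\<in>A. \<forall>u v. smooth_on (snd c ` fst c) (\<lambda>x. chart_metric A g c x u v))"

text \<open>
  The Levi-Civita connection in a chart: \<open>\<Gamma>(u, v)\<close> at \<open>x\<close> is the covariant derivative of the
  field with constant components \<open>v\<close> in direction \<open>u\<close>, so that symmetry of \<open>\<Gamma>\<close> is vanishing
  torsion and the last condition is compatibility with the metric.
\<close>

definition christoffel ::
  "('a, 'e::euclidean_space) atlas \<Rightarrow> ('a, 'e) metric \<Rightarrow> ('a, 'e) chart \<Rightarrow> 'e \<Rightarrow> 'e \<Rightarrow> 'e \<Rightarrow> 'e"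
  where
  "christoffel A g c x = (THE \<Gamma>. bilinear \<Gamma> \<and> (\<forall>u v. \<Gamma> u v = \<Gamma> v u) \<and>
     (\<forall>u v w. frechet_derivative (\<lambda>y. chart_metric A g c y v w) (at x) u =
        chart_metric A g c x (\<Gamma> u v) w + chart_metric A g c x v (\<Gamma> u w)))"

text \<open>
  The covariant derivative \<open>\<nabla>\<^bsub>w\<^esub> \<eta>\<close> of a vector field \<open>\<eta>\<close> of \<open>M\<close> along \<open>F\<close>, for a vector \<open>w\<close>
  tangent to \<open>F\<close>.
\<close>

definition cov_deriv ::
  "('a, 'e::euclidean_space) atlas \<Rightarrow> ('a, 'e) metric \<Rightarrow> ('a, 'd::euclidean_space) atlas
     \<Rightarrow> ('a, 'd) tvec \<Rightarrow> ('a \<Rightarrow> ('a, 'e) tvec) \<Rightarrow> ('a, 'e) tvec" where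
  "cov_deriv M g F w \<eta> =
     (let p = fst w in
      (p, \<lambda>c. if c \<in> charts_at M p
              then dir_deriv F (\<lambda>q. snd (\<eta> q) c) w +
                   christoffel M g c (snd c p) (snd (push F M w) c) (snd (\<eta> p) c)
              else 0))"

definition lc_connection ::
  "('a, 'e::euclidean_space) atlas \<Rightarrow> ('a, 'e) metric \<Rightarrow> ('a, 'd::euclidean_space) atlas
     \<Rightarrow> ('a \<Rightarrow> ('a, 'd) tvec) \<Rightarrow> ('a \<Rightarrow> ('a, 'd) tvec) \<Rightarrow> 'a \<Rightarrow> ('a, 'e) tvec" where
  "lc_connection M g F X Y p = cov_deriv M g F (X p) (\<lambda>q. push F M (Y q))"

definition totally_geodesic ::
  "('a, 'e::euclidean_space) atlas
     \<Rightarrow> (('a \<Rightarrow> ('a, 'd) tvec) \<Rightarrow> ('a \<Rightarrow> ('a, 'd) tvec) \<Rightarrow> 'a \<Rightarrow> ('a, 'e) tvec)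
     \<Rightarrow> ('a, 'd::euclidean_space) atlas \<Rightarrow> bool" where
  "totally_geodesic M D F \<longleftrightarrow>
     (\<forall>X Y. tangent_field F X \<and> tangent_field F Y \<longrightarrow>
        (\<forall>p\<in>pts F. D X Y p \<in> push F M ` tangent_space F p))"

definition coord_cov :: "('e \<Rightarrow> 'e \<Rightarrow> 'e \<Rightarrow> 'e) \<Rightarrow> ('e \<Rightarrow> 'e) \<Rightarrow> ('e \<Rightarrow> 'e) \<Rightarrow> 'e \<Rightarrow> 'e::euclidean_space"
  where
  "coord_cov \<Gamma> X Y x = frechet_derivative Y (at x) (X x) + \<Gamma> x (X x) (Y x)"

definition coord_bracket :: "('e \<Rightarrow> 'e) \<Rightarrow> ('e \<Rightarrow> 'e) \<Rightarrow> 'e \<Rightarrow> 'e::euclidean_space" where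
  "coord_bracket X Y x =
     frechet_derivative Y (at x) (X x) - frechet_derivative X (at x) (Y x)"

definition coord_curvature ::
  "('e \<Rightarrow> 'e \<Rightarrow> 'e \<Rightarrow> 'e) \<Rightarrow> ('e \<Rightarrow> 'e) \<Rightarrow> ('e \<Rightarrow> 'e) \<Rightarrow> ('e \<Rightarrow> 'e) \<Rightarrow> 'e \<Rightarrow> 'e::euclidean_space"
  where
  "coord_curvature \<Gamma> X Y Z x =
     coord_cov \<Gamma> X (coord_cov \<Gamma> Y Z) x - coord_cov \<Gamma> Y (coord_cov \<Gamma> X Z) x -
     coord_cov \<Gamma> (coord_bracket X Y) Z x"

text \<open>
  \<open>R(u, v) w\<close> for tangent vectors with a common base point. Since \<open>R\<close> is a tensor, the vectors may
  be extended to arbitrary vector fields; here they are extended with constant components in the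
  chart.
\<close>

definition curvature ::
  "('a, 'e::euclidean_space) atlas \<Rightarrow> ('a, 'e) metric
     \<Rightarrow> ('a, 'e) tvec \<Rightarrow> ('a, 'e) tvec \<Rightarrow> ('a, 'e) tvec \<Rightarrow> ('a, 'e) tvec" where
  "curvature A g u v w =
     (let p = fst u in
      (p, \<lambda>c. if c \<in> charts_at A p
              then coord_curvature (christoffel A g c)
                     (\<lambda>_. snd u c) (\<lambda>_. snd v c) (\<lambda>_. snd w c) (snd c p)
              else 0))"

section \<open>The Sasaki metric and the \<open>\<xi>\<close>-connection\<close>

text \<open>
  The connection map. A vector tangent to the tangent bundle at \<open>\<xi>\<close> has components
  \<open>(a, b)\<close> in the chart induced by \<open>c\<close>.
\<close>

definition connection_map ::
  "('a, 'e::euclidean_space) atlas \<Rightarrow> ('a, 'e) metric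
     \<Rightarrow> (('a, 'e) tvec, 'e \<times> 'e) tvec \<Rightarrow> ('a, 'e) tvec" where
  "connection_map M g V =
     (let \<xi> = fst V; p = fst \<xi> in
      (p, \<lambda>c. if c \<in> charts_at M p
              then let (a, b) = snd V (induced_chart M c)
                   in b + christoffel M g c (snd c p) a (snd \<xi> c)
              else 0))"

definition sasaki_metric ::
  "('a, 'e::euclidean_space) atlas \<Rightarrow> ('a, 'e) metric \<Rightarrow> (('a, 'e) tvec, 'e \<times> 'e) metric" where
  "sasaki_metric M g V W =
     g (differential (tangent_bundle M) M fst V) (differential (tangent_bundle M) M fst W) +
     g (connection_map M g V) (connection_map M g W)"

definition xi_connection ::
  "('a, 'e::euclidean_space) atlas \<Rightarrow> ('a, 'e) metric \<Rightarrow> ('a, 'd::euclidean_space) atlas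
     \<Rightarrow> ('a \<Rightarrow> ('a, 'e) tvec)
     \<Rightarrow> ('a \<Rightarrow> ('a, 'd) tvec) \<Rightarrow> ('a \<Rightarrow> ('a, 'd) tvec) \<Rightarrow> 'a \<Rightarrow> ('a, 'e) tvec" where
  "xi_connection M g F \<xi> X Y p =
     tadd (lc_connection M g F X Y p)
       (tscale (1/2)
         (tadd (curvature M g (\<xi> p) (cov_deriv M g F (X p) \<xi>) (push F M (Y p)))
               (curvature M g (\<xi> p) (cov_deriv M g F (Y p) \<xi>) (push F M (X p)))))"

end

theory Submission
  imports Defs
begin

text \<open>
  The differential of \<open>\<xi>\<close> maps a vector \<open>X\<close> tangent to \<open>F\<close> to the vector whose horizontal part is \<open>X\<close>
  and whose vertical part is \<open>\<nabla>\<^bsub>X\<^esub> \<xi>\<close>. By the formulas for the Levi-Civita connection of the Sasaki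
  metric, its covariant derivative of \<open>\<xi>\<^sub>* Y\<close> along \<open>\<xi>\<^sub>* X\<close> has as horizontal part the
  \<open>\<xi>\<close>-connection of \<open>X\<close> and \<open>Y\<close>, and as vertical part \<open>\<nabla>\<^bsub>X\<^esub> \<nabla>\<^bsub>Y\<^esub> \<xi> - R(X, Y) \<xi> / 2\<close>. It is tangent to
  the image of \<open>\<xi>\<close> iff it equals \<open>\<xi>\<^sub>* w\<close> for some \<open>w\<close> tangent to \<open>F\<close>, and comparing horizontal and
  vertical parts gives the two conditions.

  The Christoffel symbols of the Sasaki metric are identified by guessing them and using uniqueness of
  the metric torsion-free connection. The transformation law of the Christoffel symbols of \<open>M\<close> is needed
  only to see that the connection map is tensorial, which makes the Sasaki metric computable in a chart.
\<close>

section \<open>Derivatives\<close>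

text \<open>\<open>christoffel\<close> is a description, so nothing is known of it, not even that it
  can be differentiated, before existence and uniqueness of the connection are established. The
  Koszul formula gives existence and, read as a linear system, also the differentiability on which
  curvature rests. That the guessed Sasaki symbols are symmetric and metric reduces to the classical
  symmetries of \<open>R\<close>. The factor 1/2 is forced by symmetry: without correction the
  vertical part has the antisymmetric part R(A, B) \<xi> / 2. Tangent vectors are families of
  components over all charts, so the final comparison is made separately in each chart. Every chart
  of \<open>tangent_bundle M\<close> at \<open>\<xi> p\<close> is induced by a chart of
  \<open>M\<close> at \<open>p\<close>; hence, for a fixed \<open>w\<close>, equality in all induced
  charts amounts to the horizontal and vertical equalities in all charts of \<open>M\<close>. Both
  conditions must hold with one and the same \<open>w\<close>. Its existence in the horizontal
  equation is (a); as \<open>push\<close> is injective, it is the vector that \<open>pull\<close>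
  selects in (b).\<close>

abbreviation D :: "('a::real_normed_vector \<Rightarrow> 'b::real_normed_vector) \<Rightarrow> 'a \<Rightarrow> 'a \<Rightarrow> 'b" where
  "D f x \<equiv> frechet_derivative f (at x)"

lemma D_eqI: "(f has_derivative f') (at x) \<Longrightarrow> D f x = f'"
  by (rule frechet_derivative_at[symmetric])

text \<open>Holds also where no derivative exists: \<open>frechet_derivative\<close> is a choice
  among the derivatives at \<open>x\<close>, and locally equal functions have the same ones.\<close>

lemma D_cong:
  assumes "open S" "x \<in> S" "\<And>y. y \<in> S \<Longrightarrow> f y = g y"
  shows "D f x = D g x"
proof -
  have "(f has_derivative f') (at x) \<longleftrightarrow> (g has_derivative f') (at x)" for f'
    using assms by (metis has_derivative_transform_within_open)
  then show ?thesis
    by (simp add: frechet_derivative_def)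
qed

lemma differentiable_cong_open:
  assumes "open S" "x \<in> S" "\<And>y. y \<in> S \<Longrightarrow> f y = g y"
  shows "f differentiable (at x) \<longleftrightarrow> g differentiable (at x)"
  using assms unfolding differentiable_def by (metis has_derivative_transform_within_open)

lemma times_differentiable_on_cong:
  assumes "open S" "\<And>x. x \<in> S \<Longrightarrow> f x = g x"
  shows "times_differentiable_on k S f \<longleftrightarrow> times_differentiable_on k S g"
  using assms(2)
proof (induction k arbitrary: f g)
  case 0
  then show ?case by (simp cong: continuous_on_cong)
next
  case (Suc k)
  have "times_differentiable_on k S (\<lambda>x. D f x v) \<longleftrightarrow> times_differentiable_on k S (\<lambda>x. D g x v)" for v
    using Suc.prems by (intro Suc.IH) (metis D_cong[OF assms(1)])
  then show ?case
    using differentiable_cong_open[OF assms(1), of _ f g] Suc.prems by auto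
qed

lemma smooth_on_cong:
  assumes "open S" "\<And>x. x \<in> S \<Longrightarrow> f x = g x"
  shows "smooth_on S f \<longleftrightarrow> smooth_on S g"
  using times_differentiable_on_cong[OF assms] by (auto simp: smooth_on_def)

lemma smooth_on_differentiable: "smooth_on S f \<Longrightarrow> x \<in> S \<Longrightarrow> f differentiable (at x)"
  unfolding smooth_on_def by (metis times_differentiable_on.simps(2))

lemma smooth_on_D: "smooth_on S f \<Longrightarrow> smooth_on S (\<lambda>x. D f x v)"
  unfolding smooth_on_def by (metis times_differentiable_on.simps(2))

lemma smooth_on_continuous: "smooth_on S f \<Longrightarrow> continuous_on S f"
  unfolding smooth_on_def by (metis times_differentiable_on.simps(1))

lemma smooth_on_has_derivative:
  "smooth_on S f \<Longrightarrow> x \<in> S \<Longrightarrow> (f has_derivative D f x) (at x)"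
  using smooth_on_differentiable frechet_derivative_works by blast

lemma smooth_on_linear: "smooth_on S f \<Longrightarrow> x \<in> S \<Longrightarrow> linear (D f x)"
  by (simp add: linear_frechet_derivative smooth_on_differentiable)

lemma times_differentiable_on_linear:
  assumes "open S" "bounded_linear L" "times_differentiable_on k S f"
  shows "times_differentiable_on k S (\<lambda>x. L (f x))"
  using assms(3)
proof (induction k arbitrary: f)
  case 0
  then show ?case
    using bounded_linear.continuous_on[OF assms(2)] by auto
next
  case (Suc k)
  have d: "((\<lambda>x. L (f x)) has_derivative (\<lambda>h. L (D f x h))) (at x)" if "x \<in> S" for x
    using Suc.prems that
    by (auto intro!: bounded_linear.has_derivative[OF assms(2)] simp: frechet_derivative_works)
  have "times_differentiable_on k S (\<lambda>x. D (\<lambda>x. L (f x)) x v)" for v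
  proof -
    have "times_differentiable_on k S (\<lambda>x. L (D f x v))"
      using Suc by simp
    then show ?thesis
      using times_differentiable_on_cong[OF assms(1), of "\<lambda>x. D (\<lambda>x. L (f x)) x v"] D_eqI[OF d] by simp
  qed
  with d show ?case
    by (auto simp: differentiable_def)
qed

lemma smooth_on_bounded_linear:
  "open S \<Longrightarrow> bounded_linear L \<Longrightarrow> smooth_on S f \<Longrightarrow> smooth_on S (\<lambda>x. L (f x))"
  by (simp add: smooth_on_def times_differentiable_on_linear)

text \<open>Product rule for a varying linear map applied to a varying vector. Differentiability is
  given only for each fixed argument, so the vector is expanded in the basis, which leaves finitely
  many scalar products.\<close>

lemma has_derivative_linear_family:
  fixes B :: "'a::real_normed_vector \<Rightarrow> 'b::euclidean_space \<Rightarrow> 'c::real_normed_vector"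
  assumes lin: "\<forall>\<^sub>F y in nhds x. linear (B y)"
    and B: "\<And>u. (\<lambda>y. B y u) differentiable (at x)"
    and Y: "(Y has_derivative Y') (at x)"
  shows "((\<lambda>y. B y (Y y)) has_derivative (\<lambda>h. D (\<lambda>y. B y (Y x)) x h + B x (Y' h))) (at x)"
proof -
  have lx: "linear (B x)"
    using lin by (rule eventually_nhds_x_imp_x)
  have exp: "(\<Sum>b\<in>Basis. (u \<bullet> b) *\<^sub>R L b) = L u" if "linear L" for L :: "'b \<Rightarrow> 'c" and u
    using that by (metis (no_types, lifting) euclidean_representation linear_scale linear_sum sum.cong)
  have ev: "\<forall>\<^sub>F y in at x. linear (B y)"
    using lin by (simp add: eventually_nhds_conv_at)
  have dB: "((\<lambda>y. B y u) has_derivative D (\<lambda>y. B y u) x) (at x)" for u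
    using B by (simp add: frechet_derivative_works)
  have "((\<lambda>y. \<Sum>b\<in>Basis. (Y y \<bullet> b) *\<^sub>R B y b) has_derivative
      (\<lambda>h. \<Sum>b\<in>Basis. (Y x \<bullet> b) *\<^sub>R D (\<lambda>y. B y b) x h + (Y' h \<bullet> b) *\<^sub>R B x b)) (at x)"
    by (intro derivative_intros Y dB)
  then have 1: "((\<lambda>y. B y (Y y)) has_derivative
      (\<lambda>h. \<Sum>b\<in>Basis. (Y x \<bullet> b) *\<^sub>R D (\<lambda>y. B y b) x h + (Y' h \<bullet> b) *\<^sub>R B x b)) (at x)"
    by (rule has_derivative_transform_eventually) (use exp lx ev in \<open>auto elim: eventually_mono\<close>)
  \<comment> \<open>With constant coefficients the same expansion gives the derivative of
    \<open>B y u\<close>; at \<open>u = Y x\<close> it is the first half of the sum above.\<close>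
  have "((\<lambda>y. \<Sum>b\<in>Basis. (u \<bullet> b) *\<^sub>R B y b) has_derivative
      (\<lambda>h. \<Sum>b\<in>Basis. (u \<bullet> b) *\<^sub>R D (\<lambda>y. B y b) x h)) (at x)" for u
    by (intro derivative_intros dB)
  then have "((\<lambda>y. B y u) has_derivative (\<lambda>h. \<Sum>b\<in>Basis. (u \<bullet> b) *\<^sub>R D (\<lambda>y. B y b) x h)) (at x)" for u
    by (rule has_derivative_transform_eventually) (use exp lx ev in \<open>auto elim: eventually_mono\<close>)
  then have "(\<Sum>b\<in>Basis. (u \<bullet> b) *\<^sub>R D (\<lambda>y. B y b) x h) = D (\<lambda>y. B y u) x h" for u h
    by (metis D_eqI)
  with 1 show ?thesis
    by (simp add: sum.distrib exp[OF lx])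
qed

text \<open>Differentiation respects linear combinations and derivatives are unique, so linearity
  near \<open>x\<close> passes to the derivative. This makes the derivatives of \<open>G\<close> and
  \<Gamma> linear in every slot.\<close>

lemma linear_D_family:
  fixes B :: "'a::real_normed_vector \<Rightarrow> 'b::euclidean_space \<Rightarrow> 'c::real_normed_vector"
  assumes lin: "\<forall>\<^sub>F y in nhds x. linear (B y)"
    and B: "\<And>u. (\<lambda>y. B y u) differentiable (at x)"
  shows "linear (\<lambda>u. D (\<lambda>y. B y u) x h)"
proof -
  have ev: "\<forall>\<^sub>F y in at x. linear (B y)" and lx: "linear (B x)"
    using lin eventually_nhds_x_imp_x[OF lin] by (auto simp: eventually_nhds_conv_at)
  have dB: "((\<lambda>y. B y u) has_derivative D (\<lambda>y. B y u) x) (at x)" for u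
    using B by (simp add: frechet_derivative_works)
  show ?thesis
  proof (rule linearI)
    fix u v
    have "((\<lambda>y. B y u + B y v) has_derivative (\<lambda>h. D (\<lambda>y. B y u) x h + D (\<lambda>y. B y v) x h)) (at x)"
      by (intro derivative_intros dB)
    then have "((\<lambda>y. B y (u + v)) has_derivative (\<lambda>h. D (\<lambda>y. B y u) x h + D (\<lambda>y. B y v) x h)) (at x)"
      by (rule has_derivative_transform_eventually)
        (use lx ev in \<open>auto elim: eventually_mono simp: linear_add\<close>)
    then show "D (\<lambda>y. B y (u + v)) x h = D (\<lambda>y. B y u) x h + D (\<lambda>y. B y v) x h"
      by (simp add: D_eqI)
  next
    fix c u
    have "((\<lambda>y. c *\<^sub>R B y u) has_derivative (\<lambda>h. c *\<^sub>R D (\<lambda>y. B y u) x h)) (at x)"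
      by (intro derivative_intros dB)
    then have "((\<lambda>y. B y (c *\<^sub>R u)) has_derivative (\<lambda>h. c *\<^sub>R D (\<lambda>y. B y u) x h)) (at x)"
      by (rule has_derivative_transform_eventually)
        (use lx ev in \<open>auto elim: eventually_mono simp: linear_scale\<close>)
    then show "D (\<lambda>y. B y (c *\<^sub>R u)) x h = c *\<^sub>R D (\<lambda>y. B y u) x h"
      by (simp add: D_eqI)
  qed
qed

text \<open>The base point moves too, which gives three terms. The linear rule is applied first to
  the second argument with the first one fixed, then to the first.\<close>

lemma has_derivative_bilinear_family:
  fixes B :: "'a::real_normed_vector \<Rightarrow> 'b::euclidean_space \<Rightarrow> 'b2::euclidean_space \<Rightarrow> 'c::real_normed_vector"
  assumes "open S" "\<phi> x \<in> S" and bil: "\<And>y. y \<in> S \<Longrightarrow> bilinear (B y)"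
    and B: "\<And>u v. (\<lambda>y. B y u v) differentiable (at (\<phi> x))"
    and \<phi>: "(\<phi> has_derivative \<phi>') (at x)"
    and U: "(U has_derivative U') (at x)" and V: "(V has_derivative V') (at x)"
  shows "((\<lambda>y. B (\<phi> y) (U y) (V y)) has_derivative
    (\<lambda>h. D (\<lambda>y. B y (U x) (V x)) (\<phi> x) (\<phi>' h) + B (\<phi> x) (U' h) (V x) + B (\<phi> x) (U x) (V' h))) (at x)"
proof -
  \<comment> \<open>Continuity of \<phi> at \<open>x\<close> keeps nearby values in
    \<open>S\<close>, where the form is bilinear.\<close>
  have "\<phi> \<midarrow>x\<rightarrow> \<phi> x"
    using has_derivative_continuous[OF \<phi>] by (simp add: continuous_at)
  then have "\<forall>\<^sub>F y in at x. \<phi> y \<in> S"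
    using assms(1,2) by (rule topological_tendstoD)
  then have "\<forall>\<^sub>F y in nhds x. \<phi> y \<in> S"
    using assms(2) by (simp add: eventually_nhds_conv_at)
  then have ev: "\<forall>\<^sub>F y in nhds x. bilinear (B (\<phi> y))"
    by (rule eventually_mono) (rule bil)
  have d1: "((\<lambda>y. B (\<phi> y) u v) has_derivative (\<lambda>h. D (\<lambda>y. B y u v) (\<phi> x) (\<phi>' h))) (at x)" for u v
    using has_derivative_compose[OF \<phi>, of "\<lambda>y. B y u v"] B[of u v] by (simp add: frechet_derivative_works)
  have "((\<lambda>y. B (\<phi> y) u (V y)) has_derivative
      (\<lambda>h. D (\<lambda>y. B (\<phi> y) u (V x)) x h + B (\<phi> x) u (V' h))) (at x)" for u
    by (rule has_derivative_linear_family[OF _ _ V])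
      (use ev d1 in \<open>auto elim: eventually_mono simp: bilinear_def differentiable_def\<close>)
  then have d2: "((\<lambda>y. B (\<phi> y) u (V y)) has_derivative
      (\<lambda>h. D (\<lambda>y. B y u (V x)) (\<phi> x) (\<phi>' h) + B (\<phi> x) u (V' h))) (at x)" for u
    by (simp add: D_eqI[OF d1])
  have "((\<lambda>y. B (\<phi> y) (U y) (V y)) has_derivative
      (\<lambda>h. D (\<lambda>y. B (\<phi> y) (U x) (V y)) x h + B (\<phi> x) (U' h) (V x))) (at x)"
    by (rule has_derivative_linear_family[where B = "\<lambda>y u. B (\<phi> y) u (V y)", OF _ _ U])
      (use ev d2 in \<open>auto elim: eventually_mono simp: bilinear_def differentiable_def\<close>)
  then show ?thesis
    by (simp add: D_eqI[OF d2] algebra_simps)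
qed

section \<open>Symmetry of second derivatives, by the mean value theorem applied twice\<close>

lemma second_difference_mean_value:
  fixes f :: "'a::real_normed_vector \<Rightarrow> real"
  assumes sm: "smooth_on (ball x r) f" and t: "0 < t" "t * (norm u + norm v) < r"
  obtains a b where "0 < a" "a < t" "0 < b" "b < t"
    "f (x + t *\<^sub>R u + t *\<^sub>R v) - f (x + t *\<^sub>R u) - f (x + t *\<^sub>R v) + f x
       = t * t * D (\<lambda>y. D f y u) (x + a *\<^sub>R u + b *\<^sub>R v) v"
proof -
  have inb: "x + a *\<^sub>R u + b *\<^sub>R v \<in> ball x r" if "0 \<le> a" "a \<le> t" "0 \<le> b" "b \<le> t" for a b
  proof -
    have "norm (a *\<^sub>R u + b *\<^sub>R v) \<le> a * norm u + b * norm v"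
      using norm_triangle_ineq[of "a *\<^sub>R u" "b *\<^sub>R v"] that by simp
    also have "\<dots> \<le> t * norm u + t * norm v"
      using that by (intro add_mono mult_right_mono) auto
    finally show ?thesis
      using t by (simp add: dist_norm norm_minus_commute algebra_simps)
  qed
  have df: "(f has_derivative D f (x + a *\<^sub>R u + b *\<^sub>R v)) (at (x + a *\<^sub>R u + b *\<^sub>R v))"
    if "0 \<le> a" "a \<le> t" "0 \<le> b" "b \<le> t" for a b
    using smooth_on_has_derivative[OF sm inb[OF that]] .
  \<comment> \<open>\<open>p t - p 0\<close> is the second difference. The mean value theorem in
    direction \<open>u\<close> turns it into a first difference of the derivative, to which it
    applies again in direction \<open>v\<close>.\<close>
  define p where "p a = f (x + a *\<^sub>R u + t *\<^sub>R v) - f (x + a *\<^sub>R u)" for a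
  have dp: "(p has_real_derivative (D f (x + a *\<^sub>R u + t *\<^sub>R v) u - D f (x + a *\<^sub>R u) u)) (at a)"
    if "0 \<le> a" "a \<le> t" for a
  proof -
    have 1: "((\<lambda>a. x + a *\<^sub>R u + b *\<^sub>R v) has_derivative (\<lambda>h. h *\<^sub>R u)) (at a)" for b
      by (auto intro!: derivative_eq_intros)
    have "((\<lambda>a. f (x + a *\<^sub>R u + b *\<^sub>R v)) has_real_derivative D f (x + a *\<^sub>R u + b *\<^sub>R v) u) (at a)"
      if "0 \<le> b" "b \<le> t" for b
      using has_derivative_compose[OF 1 df[OF \<open>0 \<le> a\<close> \<open>a \<le> t\<close> that]]
        linear_scale[OF smooth_on_linear[OF sm inb[OF \<open>0 \<le> a\<close> \<open>a \<le> t\<close> that]]]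
      by (simp add: has_field_derivative_def mult_commute_abs)
    from this[of t] this[of 0] show ?thesis
      using t(1) unfolding p_def by (auto intro!: DERIV_diff)
  qed
  obtain a where a: "0 < a" "a < t"
    "p t - p 0 = (t - 0) * (D f (x + a *\<^sub>R u + t *\<^sub>R v) u - D f (x + a *\<^sub>R u) u)"
    using MVT2[of 0 t p "\<lambda>a. D f (x + a *\<^sub>R u + t *\<^sub>R v) u - D f (x + a *\<^sub>R u) u"] t(1) dp by metis
  define q where "q b = D f (x + a *\<^sub>R u + b *\<^sub>R v) u" for b
  have dq: "(q has_real_derivative D (\<lambda>y. D f y u) (x + a *\<^sub>R u + b *\<^sub>R v) v) (at b)"
    if "0 \<le> b" "b \<le> t" for b
  proof -
    have 1: "((\<lambda>b. x + a *\<^sub>R u + b *\<^sub>R v) has_derivative (\<lambda>h. h *\<^sub>R v)) (at b)"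
      by (auto intro!: derivative_eq_intros)
    have i: "x + a *\<^sub>R u + b *\<^sub>R v \<in> ball x r"
      using inb a that by simp
    show ?thesis
      using has_derivative_compose[OF 1 smooth_on_has_derivative[OF smooth_on_D[OF sm, of u] i]]
        linear_scale[OF smooth_on_linear[OF smooth_on_D[OF sm, of u] i]]
      unfolding q_def by (simp add: has_field_derivative_def mult_commute_abs)
  qed
  obtain b where b: "0 < b" "b < t"
    "q t - q 0 = (t - 0) * D (\<lambda>y. D f y u) (x + a *\<^sub>R u + b *\<^sub>R v) v"
    using MVT2[of 0 t q "\<lambda>b. D (\<lambda>y. D f y u) (x + a *\<^sub>R u + b *\<^sub>R v) v"] t(1) dq by metis
  have "p t - p 0 = t * t * D (\<lambda>y. D f y u) (x + a *\<^sub>R u + b *\<^sub>R v) v"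
    using a(3) b(3) by (simp add: q_def)
  then show thesis
    using that[OF a(1,2) b(1,2)] by (simp add: p_def)
qed

text \<open>The second difference does not change when \<open>u\<close> and \<open>v\<close> are
  interchanged, so the two mixed derivatives share a value at points as close to \<open>x\<close> as
  desired. Continuity then rules out a gap at \<open>x\<close>.\<close>

lemma D_D_commute_real:
  fixes f :: "'a::real_normed_vector \<Rightarrow> real"
  assumes "open S" "x \<in> S" "smooth_on S f"
  shows "D (\<lambda>y. D f y u) x v = D (\<lambda>y. D f y v) x u"
proof (rule ccontr)
  let ?P = "\<lambda>y. D (\<lambda>y. D f y u) y v" and ?Q = "\<lambda>y. D (\<lambda>y. D f y v) y u"
  assume "?P x \<noteq> ?Q x"
  \<comment> \<open>Half the gap: values within \<open>e\<close> of \<open>?P x\<close> and of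
    \<open>?Q x\<close> cannot coincide.\<close>
  define e where "e = \<bar>?P x - ?Q x\<bar> / 2"
  have e: "e > 0"
    using \<open>?P x \<noteq> ?Q x\<close> by (simp add: e_def)
  obtain r0 where r0: "r0 > 0" "ball x r0 \<subseteq> S"
    using assms(1,2) openE by blast
  have "continuous_on S ?P" "continuous_on S ?Q"
    by (intro smooth_on_continuous smooth_on_D assms)+
  then have "isCont ?P x" "isCont ?Q x"
    using assms(1,2) continuous_on_eq_continuous_at by blast+
  then obtain r1 r2 where r1: "r1 > 0" "\<And>y. dist y x < r1 \<Longrightarrow> \<bar>?P y - ?P x\<bar> < e"
    and r2: "r2 > 0" "\<And>y. dist y x < r2 \<Longrightarrow> \<bar>?Q y - ?Q x\<bar> < e"
    unfolding continuous_at_eps_delta dist_real_def using e by metis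
  define r where "r = min r0 (min r1 r2)"
  have r: "r > 0"
    using r0 r1 r2 by (simp add: r_def)
  have mono: "smooth_on (ball x r) f"
  proof -
    have sub: "ball x r \<subseteq> S"
      using r0 by (auto simp: r_def)
    have "times_differentiable_on k T f" if "times_differentiable_on k S f" "T \<subseteq> S"
      for k T and f :: "'a \<Rightarrow> real"
      using that by (induction k arbitrary: f) (auto intro: continuous_on_subset)
    then show ?thesis
      using assms(3) sub unfolding smooth_on_def by blast
  qed
  \<comment> \<open>Chosen for \<open>t * (norm u + norm v) < r\<close>; the \<open>+ 1\<close>
    keeps the denominator positive when \<open>u\<close> and \<open>v\<close> are 0.\<close>
  define t where "t = r / (2 * (norm u + norm v + 1))"
  have pos: "norm u + norm v + 1 > 0"
    by (smt (verit) norm_ge_zero)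
  have t: "0 < t"
    using r pos by (simp add: t_def)
  have "t * (norm u + norm v) < t * (2 * (norm u + norm v + 1))"
    using t pos by (smt (verit) mult_strict_left_mono norm_ge_zero)
  also have "\<dots> = r"
    using pos by (simp add: t_def)
  finally have tr: "t * (norm u + norm v) < r" .
  have inr: "dist (x + a *\<^sub>R u + b *\<^sub>R v) x < r" if "0 < a" "a < t" "0 < b" "b < t" for a b
  proof -
    have "norm (a *\<^sub>R u + b *\<^sub>R v) \<le> a * norm u + b * norm v"
      using norm_triangle_ineq[of "a *\<^sub>R u" "b *\<^sub>R v"] that by simp
    also have "\<dots> \<le> t * norm u + t * norm v"
      using that by (intro add_mono mult_right_mono) auto
    finally show ?thesis
      using tr by (simp add: dist_norm algebra_simps)
  qed
  obtain a b where ab: "0 < a" "a < t" "0 < b" "b < t"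
    "f (x + t *\<^sub>R u + t *\<^sub>R v) - f (x + t *\<^sub>R u) - f (x + t *\<^sub>R v) + f x = t * t * ?P (x + a *\<^sub>R u + b *\<^sub>R v)"
    using second_difference_mean_value[OF mono t tr] by blast
  obtain a' b' where ab': "0 < a'" "a' < t" "0 < b'" "b' < t"
    "f (x + t *\<^sub>R v + t *\<^sub>R u) - f (x + t *\<^sub>R v) - f (x + t *\<^sub>R u) + f x = t * t * ?Q (x + a' *\<^sub>R v + b' *\<^sub>R u)"
    using second_difference_mean_value[OF mono t, of v u] tr by (auto simp: add.commute)
  have "?P (x + a *\<^sub>R u + b *\<^sub>R v) = ?Q (x + b' *\<^sub>R u + a' *\<^sub>R v)"
  proof -
    have "t * t * ?P (x + a *\<^sub>R u + b *\<^sub>R v) = t * t * ?Q (x + a' *\<^sub>R v + b' *\<^sub>R u)"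
      using ab(5) ab'(5) by (simp add: algebra_simps)
    then show ?thesis
      using t by (simp add: algebra_simps)
  qed
  moreover have "\<bar>?P (x + a *\<^sub>R u + b *\<^sub>R v) - ?P x\<bar> < e"
    using inr[OF ab(1-4)] by (intro r1(2)) (simp add: r_def)
  moreover have "\<bar>?Q (x + b' *\<^sub>R u + a' *\<^sub>R v) - ?Q x\<bar> < e"
    using inr[OF ab'(3,4,1,2)] by (intro r2(2)) (simp add: r_def)
  ultimately have "\<bar>?P x - ?Q x\<bar> < 2 * e"
    by linarith
  then show False
    by (simp add: e_def)
qed

lemma D_D_commute:
  fixes f :: "'a::real_normed_vector \<Rightarrow> 'b::euclidean_space"
  assumes "open S" "x \<in> S" "smooth_on S f"
  shows "D (\<lambda>y. D f y u) x v = D (\<lambda>y. D f y v) x u"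
proof (rule euclidean_eqI)
  fix b :: 'b assume "b \<in> Basis"
  have sm: "smooth_on S (\<lambda>y. f y \<bullet> b)"
    by (rule smooth_on_bounded_linear[OF assms(1) bounded_linear_inner_left assms(3)])
  have inner: "D (\<lambda>y. h y \<bullet> b) y w = D h y w \<bullet> b" if "smooth_on S h" "y \<in> S" for h :: "'a \<Rightarrow> 'b" and y w
    using D_eqI[OF bounded_linear.has_derivative[OF bounded_linear_inner_left smooth_on_has_derivative[OF that]]]
    by metis
  have "D (\<lambda>y. D (\<lambda>y. f y \<bullet> b) y u) x v = D (\<lambda>y. D f y u) x v \<bullet> b" for u v
  proof -
    have "D (\<lambda>y. D (\<lambda>y. f y \<bullet> b) y u) x v = D (\<lambda>y. D f y u \<bullet> b) x v"
      by (rule fun_cong[OF D_cong[OF assms(1,2)]]) (simp add: inner assms)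
    then show ?thesis
      by (simp add: inner[OF smooth_on_D[OF assms(3)] assms(2)])
  qed
  then show "D (\<lambda>y. D f y u) x v \<bullet> b = D (\<lambda>y. D f y v) x u \<bullet> b"
    using D_D_commute_real[OF assms(1,2) sm] by metis
qed

section \<open>Levi-Civita connections in coordinates\<close>

definition inner_form :: "('e::real_vector \<Rightarrow> 'e \<Rightarrow> real) \<Rightarrow> bool" where
  "inner_form B \<longleftrightarrow> bilinear B \<and> (\<forall>u v. B u v = B v u) \<and> (\<forall>u. u \<noteq> 0 \<longrightarrow> B u u > 0)"

text \<open>The property under the description in \<open>christoffel\<close>, stated for an
  arbitrary coordinate metric so that it also covers \<open>sasaki_form\<close>.\<close>

definition levi_civita ::
  "('e::euclidean_space \<Rightarrow> 'e \<Rightarrow> 'e \<Rightarrow> real) \<Rightarrow> 'e \<Rightarrow> ('e \<Rightarrow> 'e \<Rightarrow> 'e) \<Rightarrow> bool" where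
  "levi_civita G x \<Gamma> \<longleftrightarrow> bilinear \<Gamma> \<and> (\<forall>u v. \<Gamma> u v = \<Gamma> v u) \<and>
     (\<forall>u v w. D (\<lambda>y. G y v w) x u = G x (\<Gamma> u v) w + G x v (\<Gamma> u w))"

definition christoffel_form ::
  "('e::euclidean_space \<Rightarrow> 'e \<Rightarrow> 'e \<Rightarrow> real) \<Rightarrow> 'e \<Rightarrow> 'e \<Rightarrow> 'e \<Rightarrow> 'e" where
  "christoffel_form G x = (THE \<Gamma>. levi_civita G x \<Gamma>)"

lemma christoffel_eq_christoffel_form: "christoffel A g c = christoffel_form (chart_metric A g c)"
  by (simp add: fun_eq_iff christoffel_def christoffel_form_def levi_civita_def)

text \<open>Alternating the two exchanges, three times each, returns to the original triple with
  three changes of sign. This is the algebra behind uniqueness of the Levi-Civita connection and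
  behind its transformation law.\<close>

lemma symmetric_skew_eq_0:
  fixes C :: "'a \<Rightarrow> 'a \<Rightarrow> 'a \<Rightarrow> real"
  assumes "\<And>u v w. C u v w = C v u w" "\<And>u v w. C u v w = - C u w v"
  shows "C u v w = 0"
proof -
  have "C u v w = - C u v w"
    by (metis assms add.inverse_inverse)
  then show ?thesis by simp
qed

lemma inner_form_nondegenerate:
  assumes "inner_form B" "\<And>w. B z w = 0"
  shows "z = 0"
  using assms unfolding inner_form_def by (metis less_irrefl)

text \<open>The difference of two solutions, paired with \<open>w\<close>, is symmetric in
  \<open>u\<close>, \<open>v\<close> by vanishing torsion and skew in \<open>v\<close>,
  \<open>w\<close> because the derivative of the metric drops out.\<close>

lemma levi_civita_unique:
  assumes B: "inner_form (G x)" and 1: "levi_civita G x \<Gamma>" and 2: "levi_civita G x \<Gamma>'"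
  shows "\<Gamma> = \<Gamma>'"
proof (intro ext)
  fix u v
  have bil: "bilinear (G x)" and sym: "\<And>u v. G x u v = G x v u"
    using B by (auto simp: inner_form_def)
  have "G x (\<Gamma> u v - \<Gamma>' u v) w = 0" for w
  proof (rule symmetric_skew_eq_0[of "\<lambda>u v w. G x (\<Gamma> u v - \<Gamma>' u v) w"])
    fix u v w
    have "\<Gamma> u v = \<Gamma> v u" "\<Gamma>' u v = \<Gamma>' v u"
      using 1 2 by (simp_all only: levi_civita_def)
    then show "G x (\<Gamma> u v - \<Gamma>' u v) w = G x (\<Gamma> v u - \<Gamma>' v u) w"
      by simp
    have "D (\<lambda>y. G y v w) x u = G x (\<Gamma> u v) w + G x v (\<Gamma> u w)"
      "D (\<lambda>y. G y v w) x u = G x (\<Gamma>' u v) w + G x v (\<Gamma>' u w)"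
      using 1 2 by (simp_all only: levi_civita_def)
    then have "G x (\<Gamma> u v) w + G x v (\<Gamma> u w) = G x (\<Gamma>' u v) w + G x v (\<Gamma>' u w)"
      by simp
    then show "G x (\<Gamma> u v - \<Gamma>' u v) w = - G x (\<Gamma> u w - \<Gamma>' u w) v"
      by (simp add: bilinear_lsub[OF bil] sym[of v])
  qed
  then show "\<Gamma> u v = \<Gamma>' u v"
    using inner_form_nondegenerate[OF B] by fastforce
qed

lemma christoffel_form_eqI:
  assumes "inner_form (G x)" "levi_civita G x \<Gamma>"
  shows "christoffel_form G x = \<Gamma>"
  unfolding christoffel_form_def using assms levi_civita_unique by blast

lemma bilinear_symI:
  assumes "\<And>u v. h u v = h v u" "\<And>v. linear (h v)"
  shows "bilinear h"
proof -
  have "(\<lambda>u. h u v) = h v" for v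
    using assms(1) by blast
  then show ?thesis
    using assms(2) by (simp add: bilinear_def)
qed

lemma differentiable_linear_solve:
  fixes L :: "'a::euclidean_space \<Rightarrow> 'b::euclidean_space \<Rightarrow> 'b"
  assumes "open S" "x \<in> S"
    and lin: "\<And>y. y \<in> S \<Longrightarrow> linear (L y)" and inj: "\<And>y. y \<in> S \<Longrightarrow> inj (L y)"
    and dL: "\<And>y u. y \<in> S \<Longrightarrow> (\<lambda>y. L y u) differentiable (at y)"
    and dk: "k differentiable (at x)"
    and sol: "\<And>y. y \<in> S \<Longrightarrow> L y (z y) = k y"
  shows "z differentiable (at x)"
proof -
  \<comment> \<open>\<open>z\<close> is read off the inverse of \<open>(y, a) \<mapsto> (y, L y a)\<close>; invariance of domain, used in
    \<open>has_derivative_inverse_strong\<close>, makes this inverse continuous for free.\<close>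
  define H where "H p = (fst p, L (fst p) (snd p))" for p :: "'a \<times> 'b"
  define g where "g p = (fst p, inv (L (fst p)) (snd p))" for p :: "'a \<times> 'b"
  have dH: "(H has_derivative (\<lambda>h. (fst h, D (\<lambda>y. L y (snd p)) (fst p) (fst h) + L (fst p) (snd h)))) (at p)"
    if "fst p \<in> S" for p
  proof -
    have fstS: "open (S \<times> (UNIV :: 'b set))" "p \<in> S \<times> UNIV"
      using assms(1) that by (auto simp: open_Times mem_Times_iff)
    have ev: "\<forall>\<^sub>F q in nhds p. linear (L (fst q))"
      unfolding eventually_nhds using fstS lin by (intro exI[of _ "S \<times> UNIV"]) auto
    have d1: "((\<lambda>q. L (fst q) u) has_derivative (\<lambda>h. D (\<lambda>y. L y u) (fst p) (fst h))) (at p)" for u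
      using has_derivative_compose[OF has_derivative_fst[OF has_derivative_ident], of "\<lambda>y. L y u" _ p]
        dL[OF that, of u] by (simp add: frechet_derivative_works)
    have "((\<lambda>q. L (fst q) (snd q)) has_derivative
        (\<lambda>h. D (\<lambda>q. L (fst q) (snd p)) p h + L (fst p) (snd h))) (at p)"
      by (rule has_derivative_linear_family[OF ev _ has_derivative_snd[OF has_derivative_ident]])
        (use d1 in \<open>auto simp: differentiable_def\<close>)
    then show ?thesis
      unfolding H_def D_eqI[OF d1] by (intro has_derivative_Pair has_derivative_fst has_derivative_ident) auto
  qed
  define p where "p = (x, z x)"
  let ?i = "\<lambda>h. (fst h, inv (L x) (snd h - D (\<lambda>y. L y (z x)) x (fst h)))"
  have surj: "L x (inv (L x) b) = b" for b
    using linear_inj_imp_surj[OF lin inj] assms(2) by (simp add: surj_f_inv_f)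
  have "(g has_derivative ?i) (at (H p))"
  proof (rule has_derivative_inverse_strong[where f = H and x = p and S = "S \<times> UNIV"])
    show "open (S \<times> (UNIV :: 'b set))" "p \<in> S \<times> UNIV"
      using assms(1,2) by (auto simp: open_Times p_def)
    show "continuous_on (S \<times> UNIV) H"
      using dH has_derivative_continuous by (intro continuous_at_imp_continuous_on) fastforce
    show "g (H q) = q" if "q \<in> S \<times> UNIV" for q
      using that inj by (auto simp: g_def H_def)
    show "(H has_derivative (\<lambda>h. (fst h, D (\<lambda>y. L y (z x)) x (fst h) + L x (snd h)))) (at p)"
      using dH[of p] assms(2) by (simp add: p_def)
    show "(\<lambda>h. (fst h, D (\<lambda>y. L y (z x)) x (fst h) + L x (snd h))) \<circ> ?i = id"
      by (auto simp: fun_eq_iff surj)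
  qed
  then have "g differentiable (at (x, k x))"
    using sol[OF assms(2)] unfolding differentiable_def H_def p_def by auto
  then obtain g' where g': "(g has_derivative g') (at (x, k x))"
    by (auto simp: differentiable_def)
  obtain k' where k': "(k has_derivative k') (at x)"
    using dk by (auto simp: differentiable_def)
  have "((\<lambda>y. snd (g (y, k y))) has_derivative (\<lambda>h. snd (g' (h, k' h)))) (at x)"
    by (rule has_derivative_snd[OF has_derivative_compose[OF has_derivative_Pair[OF has_derivative_ident k'] g']])
  then have "(\<lambda>y. snd (g (y, k y))) differentiable (at x)"
    by (auto simp: differentiable_def)
  moreover have "snd (g (y, k y)) = z y" if "y \<in> S" for y
    using inj[OF that] sol[OF that] by (metis g_def fst_conv snd_conv inv_f_f)
  ultimately show ?thesis
    using differentiable_cong_open[OF assms(1,2), of "\<lambda>y. snd (g (y, k y))" z] by auto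
qed

text \<open>A Riemannian metric on an open set of the model space. Smoothness is stated for each
  fixed pair of vectors, as in \<open>riemannian_manifold\<close>.\<close>

locale coordinate_metric =
  fixes S :: "'e::euclidean_space set" and G :: "'e \<Rightarrow> 'e \<Rightarrow> 'e \<Rightarrow> real"
  assumes open_S: "open S"
    and inner_form_G: "x \<in> S \<Longrightarrow> inner_form (G x)"
    and smooth_G: "smooth_on S (\<lambda>x. G x u v)"
begin

abbreviation \<Gamma> where "\<Gamma> \<equiv> christoffel_form G"

abbreviation R where "R x u v w \<equiv> coord_curvature \<Gamma> (\<lambda>_. u) (\<lambda>_. v) (\<lambda>_. w) x"

lemma bilinear_G: "x \<in> S \<Longrightarrow> bilinear (G x)"
  and G_sym: "x \<in> S \<Longrightarrow> G x u v = G x v u"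
  using inner_form_G by (auto simp: inner_form_def)

lemmas G_simps = bilinear_ladd[OF bilinear_G] bilinear_radd[OF bilinear_G]
  bilinear_lmul[OF bilinear_G] bilinear_rmul[OF bilinear_G]
  bilinear_lsub[OF bilinear_G] bilinear_rsub[OF bilinear_G]

lemma eventually_nhds_S: "x \<in> S \<Longrightarrow> (\<And>y. y \<in> S \<Longrightarrow> P y) \<Longrightarrow> \<forall>\<^sub>F y in nhds x. P y"
  unfolding eventually_nhds using open_S by blast

lemma differentiable_G: "x \<in> S \<Longrightarrow> (\<lambda>y. G y u v) differentiable (at x)"
  using smooth_G smooth_on_differentiable by blast

section \<open>Existence and differentiability of the Levi-Civita connection\<close>

lemma linear_DG:
  assumes "x \<in> S"
  shows "linear (\<lambda>u. D (\<lambda>y. G y v w) x u)" "linear (\<lambda>v. D (\<lambda>y. G y v w) x u)"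
    "linear (\<lambda>w. D (\<lambda>y. G y v w) x u)"
proof -
  have bil: "\<forall>\<^sub>F y in nhds x. bilinear (G y)"
    using assms bilinear_G by (intro eventually_nhds_S)
  show "linear (\<lambda>u. D (\<lambda>y. G y v w) x u)"
    using assms differentiable_G linear_frechet_derivative by blast
  show "linear (\<lambda>v. D (\<lambda>y. G y v w) x u)" "linear (\<lambda>w. D (\<lambda>y. G y v w) x u)"
    using bil assms by (auto intro!: linear_D_family differentiable_G elim!: eventually_mono
        simp: bilinear_def)
qed

text \<open>The right-hand side of the Koszul formula for constant fields, whose brackets
  vanish.\<close>

definition koszul :: "'e \<Rightarrow> 'e \<Rightarrow> 'e \<Rightarrow> 'e \<Rightarrow> real" where
  "koszul x u v w = (D (\<lambda>y. G y v w) x u + D (\<lambda>y. G y u w) x v - D (\<lambda>y. G y u v) x w) / 2"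

text \<open>Lowering an index, as an endomorphism of the model space: an equation between
  functionals becomes a linear system with the Gram matrix as coefficients.\<close>

definition gram :: "'e \<Rightarrow> 'e \<Rightarrow> 'e" where
  "gram x z = (\<Sum>b\<in>Basis. G x z b *\<^sub>R b)"

lemma linear_gram: "x \<in> S \<Longrightarrow> linear (gram x)"
  unfolding gram_def
  by (intro linearI) (simp_all add: G_simps scaleR_left_distrib sum.distrib scaleR_sum_right)

lemma gram_eq_iff:
  assumes "x \<in> S" "linear k"
  shows "gram x z = (\<Sum>b\<in>Basis. k b *\<^sub>R b) \<longleftrightarrow> (\<forall>w. G x z w = k w)"
proof
  assume "gram x z = (\<Sum>b\<in>Basis. k b *\<^sub>R b)"
  then have "gram x z \<bullet> b = (\<Sum>b\<in>Basis. k b *\<^sub>R b) \<bullet> b" for b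
    by simp
  then have eq: "G x z b = k b" if "b \<in> Basis" for b
    using that unfolding gram_def by (metis inner_sum_left_Basis)
  have "linear (G x z)"
    using bilinear_G[OF assms(1)] by (simp add: bilinear_def)
  then show "\<forall>w. G x z w = k w"
    using linear_eq_stdbasis[OF _ assms(2)] eq by blast
qed (simp add: gram_def)

lemma inj_gram:
  assumes "x \<in> S"
  shows "inj (gram x)"
proof -
  have "z = 0" if "gram x z = 0" for z
    using gram_eq_iff[OF assms module_hom_zero, of z] that inner_form_nondegenerate[OF inner_form_G[OF assms]]
    by simp
  then show ?thesis
    using linear_gram[OF assms] by (simp add: linear_injective_0)
qed

lemma linear_koszul: "x \<in> S \<Longrightarrow> linear (koszul x u v)"
  and linear_koszul2: "x \<in> S \<Longrightarrow> linear (\<lambda>v. koszul x u v w)"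
  by (intro linearI;
      simp add: koszul_def linear_add[OF linear_DG(1)] linear_scale[OF linear_DG(1)]
        linear_add[OF linear_DG(2)] linear_scale[OF linear_DG(2)]
        linear_add[OF linear_DG(3)] linear_scale[OF linear_DG(3)] field_simps)+

lemma D_G_sym: "x \<in> S \<Longrightarrow> D (\<lambda>y. G y u v) x = D (\<lambda>y. G y v u) x"
  by (rule D_cong[OF open_S]) (auto simp: G_sym)

lemma koszul_sym: "x \<in> S \<Longrightarrow> koszul x u v w = koszul x v u w"
  using D_G_sym[of x u v] by (simp add: koszul_def)

text \<open>The Koszul functional is represented by a vector because \<open>gram x\<close>,
  injective by definiteness, is surjective. Symmetry and bilinearity are inherited from
  \<open>koszul\<close> by nondegeneracy.\<close>

lemma ex_levi_civita:
  assumes x: "x \<in> S"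
  shows "\<exists>\<Gamma>. levi_civita G x \<Gamma> \<and> (\<forall>u v w. G x (\<Gamma> u v) w = koszul x u v w)"
proof -
  have "\<exists>z. \<forall>w. G x z w = koszul x u v w" for u v
  proof -
    obtain z where "(\<Sum>b\<in>Basis. koszul x u v b *\<^sub>R b) = gram x z"
      using surjD[OF linear_inj_imp_surj[OF linear_gram[OF x] inj_gram[OF x]]] by blast
    then have "\<forall>w. G x z w = koszul x u v w"
      using gram_eq_iff[OF x linear_koszul[OF x]] by metis
    then show ?thesis
      by blast
  qed
  then obtain \<Gamma> where \<Gamma>: "\<And>u v w. G x (\<Gamma> u v) w = koszul x u v w"
    by metis
  have eqI: "a = b" if "\<And>w. G x a w = G x b w" for a b
    using inner_form_nondegenerate[OF inner_form_G[OF x], of "a - b"] that x by (simp add: G_simps)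
  have sym: "\<Gamma> u v = \<Gamma> v u" for u v
    by (rule eqI) (simp add: \<Gamma> koszul_sym[OF x, of u v])
  moreover have "bilinear \<Gamma>"
  proof (rule bilinear_symI[OF sym], rule linearI)
    fix u v v' c
    show "\<Gamma> u (v + v') = \<Gamma> u v + \<Gamma> u v'" "\<Gamma> u (c *\<^sub>R v) = c *\<^sub>R \<Gamma> u v"
      by (rule eqI, simp add: x \<Gamma> G_simps linear_add[OF linear_koszul2] linear_scale[OF linear_koszul2])+
  qed
  \<comment> \<open>In the sum of the Koszul expressions for \<open>u v w\<close> and
    \<open>u w v\<close> everything cancels except the derivative in direction
    \<open>u\<close>.\<close>
  moreover have "D (\<lambda>y. G y v w) x u = G x (\<Gamma> u v) w + G x v (\<Gamma> u w)" for u v w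
    using D_G_sym[OF x, of v w] D_G_sym[OF x, of u w] D_G_sym[OF x, of u v]
    by (simp add: G_sym[OF x, of v] \<Gamma> koszul_def field_simps)
  ultimately show ?thesis
    unfolding levi_civita_def using \<Gamma> by blast
qed

lemma levi_civita_\<Gamma>: "x \<in> S \<Longrightarrow> levi_civita G x (\<Gamma> x)"
  using ex_levi_civita christoffel_form_eqI inner_form_G by metis

lemma G_\<Gamma>: "x \<in> S \<Longrightarrow> G x (\<Gamma> x u v) w = koszul x u v w"
  using ex_levi_civita christoffel_form_eqI inner_form_G by metis

lemma bilinear_\<Gamma>: "x \<in> S \<Longrightarrow> bilinear (\<Gamma> x)"
  and \<Gamma>_sym: "x \<in> S \<Longrightarrow> \<Gamma> x u v = \<Gamma> x v u"
  and D_G: "x \<in> S \<Longrightarrow> D (\<lambda>y. G y v w) x u = G x (\<Gamma> x u v) w + G x v (\<Gamma> x u w)"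
  using levi_civita_\<Gamma> by (auto simp: levi_civita_def)

lemmas \<Gamma>_simps = bilinear_ladd[OF bilinear_\<Gamma>] bilinear_radd[OF bilinear_\<Gamma>]
  bilinear_lmul[OF bilinear_\<Gamma>] bilinear_rmul[OF bilinear_\<Gamma>]
  bilinear_lsub[OF bilinear_\<Gamma>] bilinear_rsub[OF bilinear_\<Gamma>]

text \<open>\<Gamma> solves a linear system whose matrix \<open>gram y\<close> and right-hand side
  \<open>koszul\<close> depend differentiably on \<open>y\<close>.\<close>

lemma differentiable_\<Gamma>:
  assumes "x \<in> S"
  shows "(\<lambda>y. \<Gamma> y u v) differentiable (at x)"
proof (rule differentiable_linear_solve[OF open_S assms linear_gram inj_gram])
  show "(\<lambda>y. gram y u) differentiable (at y)" if "y \<in> S" for y u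
    unfolding gram_def using differentiable_G[OF that]
    by (intro differentiable_sum) auto
  show "gram y (\<Gamma> y u v) = (\<Sum>b\<in>Basis. koszul y u v b *\<^sub>R b)" if "y \<in> S" for y
    using that gram_eq_iff[OF that linear_koszul] G_\<Gamma> by blast
  show "(\<lambda>y. \<Sum>b\<in>Basis. koszul y u v b *\<^sub>R b) differentiable (at x)"
    unfolding koszul_def
    using smooth_on_differentiable[OF smooth_on_D[OF smooth_G] assms]
    by (intro differentiable_sum differentiable_scaleR differentiable_divide differentiable_diff
        differentiable_add) auto
qed

section \<open>Curvature and its symmetries\<close>

lemma linear_D\<Gamma>:
  assumes "x \<in> S"
  shows "linear (\<lambda>u. D (\<lambda>y. \<Gamma> y v w) x u)" "linear (\<lambda>v. D (\<lambda>y. \<Gamma> y v w) x u)"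
    "linear (\<lambda>w. D (\<lambda>y. \<Gamma> y v w) x u)"
proof -
  have bil: "\<forall>\<^sub>F y in nhds x. bilinear (\<Gamma> y)"
    using assms bilinear_\<Gamma> by (intro eventually_nhds_S)
  show "linear (\<lambda>u. D (\<lambda>y. \<Gamma> y v w) x u)"
    using assms differentiable_\<Gamma> linear_frechet_derivative by blast
  show "linear (\<lambda>v. D (\<lambda>y. \<Gamma> y v w) x u)" "linear (\<lambda>w. D (\<lambda>y. \<Gamma> y v w) x u)"
    using bil assms by (auto intro!: linear_D_family differentiable_\<Gamma> elim!: eventually_mono
        simp: bilinear_def)
qed

lemmas D\<Gamma>_simps =
  linear_add[OF linear_D\<Gamma>(1)] linear_scale[OF linear_D\<Gamma>(1)]
  linear_add[OF linear_D\<Gamma>(2)] linear_scale[OF linear_D\<Gamma>(2)]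
  linear_add[OF linear_D\<Gamma>(3)] linear_scale[OF linear_D\<Gamma>(3)]

lemma D_\<Gamma>_sym: "x \<in> S \<Longrightarrow> D (\<lambda>y. \<Gamma> y u v) x = D (\<lambda>y. \<Gamma> y v u) x"
  by (rule D_cong[OF open_S]) (auto simp: \<Gamma>_sym)

lemma D_\<Gamma>:
  assumes "x \<in> S"
  shows "((\<lambda>y. \<Gamma> y u v) has_derivative D (\<lambda>y. \<Gamma> y u v) x) (at x)"
  using differentiable_\<Gamma>[OF assms] by (simp add: frechet_derivative_works)

text \<open>Constant fields commute, so the bracket term of the curvature vanishes.\<close>

lemma R_eq:
  assumes "x \<in> S"
  shows "R x u v w = D (\<lambda>y. \<Gamma> y v w) x u - D (\<lambda>y. \<Gamma> y u w) x v + \<Gamma> x u (\<Gamma> x v w) - \<Gamma> x v (\<Gamma> x u w)"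
proof -
  have "coord_cov \<Gamma> (\<lambda>_. u) (\<lambda>_. v) = (\<lambda>x. \<Gamma> x u v)" for u v
    by (simp add: fun_eq_iff coord_cov_def)
  moreover have "coord_bracket (\<lambda>_. u) (\<lambda>_. v) = (\<lambda>_. 0)"
    by (simp add: fun_eq_iff coord_bracket_def)
  ultimately show ?thesis
    using assms by (simp add: coord_curvature_def coord_cov_def[of _ "\<lambda>_. u" "\<lambda>x. _ x"]
        coord_cov_def[of _ "\<lambda>_. v" "\<lambda>x. _ x"] bilinear_lzero[OF bilinear_\<Gamma>])
qed

lemma R_simps:
  assumes "x \<in> S"
  shows "R x (u + u') v w = R x u v w + R x u' v w" "R x (c *\<^sub>R u) v w = c *\<^sub>R R x u v w"
    "R x u (v + v') w = R x u v w + R x u v' w" "R x u (c *\<^sub>R v) w = c *\<^sub>R R x u v w"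
    "R x u v (w + w') = R x u v w + R x u v w'" "R x u v (c *\<^sub>R w) = c *\<^sub>R R x u v w"
  using assms by (simp_all add: R_eq \<Gamma>_simps D\<Gamma>_simps algebra_simps)

lemma R_skew: "x \<in> S \<Longrightarrow> R x u v w = - R x v u w"
  by (simp add: R_eq)

text \<open>First Bianchi identity: the terms cancel in pairs since \<Gamma> and its derivatives are
  symmetric.\<close>

lemma R_bianchi: "x \<in> S \<Longrightarrow> R x u v w + R x v w u + R x w u v = 0"
  using D_\<Gamma>_sym[of x u v] D_\<Gamma>_sym[of x v w] D_\<Gamma>_sym[of x u w]
    \<Gamma>_sym[of x u v] \<Gamma>_sym[of x v w] \<Gamma>_sym[of x u w]
  by (simp add: R_eq)

text \<open>Metric compatibility along a map:
  \<open>\<Gamma> (\<phi> x) (\<phi>' h) (U x) + U' h\<close> is the covariant derivative of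
  \<open>U\<close> along \<phi>.\<close>

lemma has_derivative_G_family:
  assumes "\<phi> x \<in> S" "(\<phi> has_derivative \<phi>') (at x)"
    "(U has_derivative U') (at x)" "(V has_derivative V') (at x)"
  shows "((\<lambda>y. G (\<phi> y) (U y) (V y)) has_derivative
    (\<lambda>h. G (\<phi> x) (\<Gamma> (\<phi> x) (\<phi>' h) (U x) + U' h) (V x)
       + G (\<phi> x) (U x) (\<Gamma> (\<phi> x) (\<phi>' h) (V x) + V' h))) (at x)"
  using has_derivative_bilinear_family[OF open_S assms(1) bilinear_G differentiable_G assms(2-4)] assms(1)
  by (simp add: D_G G_simps algebra_simps)

text \<open>The metric is differentiated twice, in directions \<open>v\<close> and \<open>u\<close>.
  Antisymmetrising in \<open>u\<close>, \<open>v\<close> removes the second derivatives, which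
  commute, and the products of two first-order terms, which are exchanged; what remains are the two
  curvature terms.\<close>

lemma R_metric_skew:
  assumes x: "x \<in> S"
  shows "G x (R x u v w) z = - G x w (R x u v z)"
proof -
  have "D (\<lambda>y. D (\<lambda>y. G y w z) y v) x u =
      G x (\<Gamma> x u (\<Gamma> x v w) + D (\<lambda>y. \<Gamma> y v w) x u) z + G x (\<Gamma> x v w) (\<Gamma> x u z)
      + (G x (\<Gamma> x u w) (\<Gamma> x v z) + G x w (\<Gamma> x u (\<Gamma> x v z) + D (\<lambda>y. \<Gamma> y v z) x u))" for u v
  proof -
    have "D (\<lambda>y. D (\<lambda>y. G y w z) y v) x u = D (\<lambda>y. G y (\<Gamma> y v w) z + G y w (\<Gamma> y v z)) x u"
      by (rule fun_cong[OF D_cong[OF open_S x]]) (simp add: D_G)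
    also have "((\<lambda>y. G y (\<Gamma> y v w) z + G y w (\<Gamma> y v z)) has_derivative (\<lambda>u.
        (G x (\<Gamma> x u (\<Gamma> x v w) + D (\<lambda>y. \<Gamma> y v w) x u) z + G x (\<Gamma> x v w) (\<Gamma> x u z + 0))
        + (G x (\<Gamma> x u w + 0) (\<Gamma> x v z) + G x w (\<Gamma> x u (\<Gamma> x v z) + D (\<lambda>y. \<Gamma> y v z) x u)))) (at x)"
      by (intro has_derivative_add has_derivative_G_family x has_derivative_ident has_derivative_const D_\<Gamma>)
    note D_eqI[OF this]
    finally show ?thesis by simp
  qed
  from this[of u v] this[of v u] show ?thesis
    using D_D_commute_real[OF open_S x smooth_G, of w z v u]
    by (simp add: R_eq[OF x] G_simps x)
qed

lemma R_pair_sym: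
  assumes x: "x \<in> S"
  shows "G x (R x u v w) z = G x (R x w z u) v"
proof -
  define r where "r u v w z = G x (R x u v w) z" for u v w z
  have 1: "r u v w z = - r v u w z" for u v w z
    unfolding r_def by (subst R_skew[OF x]) (simp add: bilinear_lneg[OF bilinear_G] x)
  have 2: "r u v w z = - r u v z w" for u v w z
    unfolding r_def R_metric_skew[OF x, of u v w] by (simp add: G_sym[OF x, of w])
  have 3: "r u v w z + r v w u z + r w u v z = 0" for u v w z
    unfolding r_def using R_bianchi[OF x, of u v w]
    by (simp flip: bilinear_ladd[OF bilinear_G[OF x]] add: bilinear_lzero[OF bilinear_G[OF x]])
  \<comment> \<open>Four Bianchi identities, each with a different vector in the last slot; the
    other facts match their terms up to sign. The sum of all four shows that
    \<open>r w u v z + r z v w u\<close> vanishes, and the sum of the first two is then the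
    claim.\<close>
  have "r u v w z = r w z u v"
    using 3[of u v w z] 3[of v w z u] 3[of w z u v] 3[of z u v w]
      2[of u v z w] 2[of w z v u] 2[of v w z u] 2[of z u w v]
      1[of u w z v] 2[of w u z v] 1[of v z u w] 2[of z v u w]
    by linarith
  then show ?thesis
    by (simp add: r_def)
qed

subsection \<open>The Sasaki metric in induced coordinates\<close>

definition vertical :: "'e \<times> 'e \<Rightarrow> 'e \<times> 'e \<Rightarrow> 'e" where
  "vertical p A = snd A + \<Gamma> (fst p) (fst A) (snd p)"

definition sasaki_form :: "'e \<times> 'e \<Rightarrow> 'e \<times> 'e \<Rightarrow> 'e \<times> 'e \<Rightarrow> real" where
  "sasaki_form p A B = G (fst p) (fst A) (fst B) + G (fst p) (vertical p A) (vertical p B)"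

text \<open>
  The coordinate form of Kowalski's formulas: for lifts of constant fields, the horizontal part of the
  Levi-Civita connection of the Sasaki metric is corrected by the terms \<open>R(\<xi>, K A) B\<close> and
  \<open>R(\<xi>, K B) A\<close>, the vertical part by \<open>R(A, B) \<xi>\<close>, each with factor \<open>1/2\<close>. Here \<open>K\<close> is
  \<open>vertical\<close>; \<open>sasaki_vertical\<close> is \<open>K\<close> of the covariant derivative, not its second component.
\<close>

definition sasaki_horizontal :: "'e \<times> 'e \<Rightarrow> 'e \<times> 'e \<Rightarrow> 'e \<times> 'e \<Rightarrow> 'e" where
  "sasaki_horizontal p A B = \<Gamma> (fst p) (fst A) (fst B) +
     (1/2) *\<^sub>R (R (fst p) (snd p) (vertical p A) (fst B) + R (fst p) (snd p) (vertical p B) (fst A))"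

definition sasaki_vertical :: "'e \<times> 'e \<Rightarrow> 'e \<times> 'e \<Rightarrow> 'e \<times> 'e \<Rightarrow> 'e" where
  "sasaki_vertical p A B = D (\<lambda>y. \<Gamma> y (fst B) (snd p)) (fst p) (fst A) + \<Gamma> (fst p) (fst B) (snd A) +
     \<Gamma> (fst p) (fst A) (vertical p B) - (1/2) *\<^sub>R R (fst p) (fst A) (fst B) (snd p)"

text \<open>The vector with prescribed first component and prescribed image under
  \<open>vertical\<close>; solving for the second component subtracts the \<Gamma> term of
  \<open>vertical\<close>.\<close>

definition sasaki_\<Gamma> :: "'e \<times> 'e \<Rightarrow> 'e \<times> 'e \<Rightarrow> 'e \<times> 'e \<Rightarrow> 'e \<times> 'e" where
  "sasaki_\<Gamma> p A B = (sasaki_horizontal p A B,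
     sasaki_vertical p A B - \<Gamma> (fst p) (sasaki_horizontal p A B) (snd p))"

lemma vertical_sasaki_\<Gamma>: "vertical p (sasaki_\<Gamma> p A B) = sasaki_vertical p A B"
  by (simp add: vertical_def sasaki_\<Gamma>_def)

lemma linear_vertical: "fst p \<in> S \<Longrightarrow> linear (vertical p)"
  by (rule linearI) (simp_all add: vertical_def \<Gamma>_simps algebra_simps)

text \<open>Definite because \<open>fst A\<close> and \<open>vertical p A\<close> together determine
  \<open>A\<close>: if the first vanishes, the second is \<open>snd A\<close>.\<close>

lemma inner_form_sasaki:
  assumes p: "fst p \<in> S"
  shows "inner_form (sasaki_form p)"
proof -
  note G = inner_form_G[OF p]
  have sym: "sasaki_form p A B = sasaki_form p B A" for A B
    using p by (simp add: sasaki_form_def G_sym)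
  moreover have "bilinear (sasaki_form p)"
    by (rule bilinear_symI[OF sym], rule linearI)
      (use p in \<open>simp_all add: sasaki_form_def G_simps linear_add[OF linear_vertical]
        linear_scale[OF linear_vertical] algebra_simps\<close>)
  moreover have "sasaki_form p A A > 0" if "A \<noteq> 0" for A
  proof (cases "fst A = 0")
    case True
    then have "vertical p A = snd A" "snd A \<noteq> 0"
      using that p by (auto simp: vertical_def bilinear_lzero[OF bilinear_\<Gamma>] prod_eq_iff)
    then show ?thesis
      using G True by (auto simp: sasaki_form_def inner_form_def bilinear_lzero[OF bilinear_G[OF p]])
  next
    case False
    then have "G (fst p) (fst A) (fst A) > 0"
      using G by (auto simp: inner_form_def)
    moreover have "G (fst p) (vertical p A) (vertical p A) \<ge> 0"
      using G bilinear_lzero[OF bilinear_G[OF p]]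
      by (cases "vertical p A = 0") (auto simp: inner_form_def less_imp_le)
    ultimately show ?thesis
      by (simp add: sasaki_form_def)
  qed
  ultimately show ?thesis
    unfolding inner_form_def by blast
qed

text \<open>Adding half the curvature back to \<open>sasaki_vertical\<close> leaves the plain
  covariant derivative of \<open>vertical q B\<close> in direction \<open>A\<close>, so this is
  metric compatibility on the base.\<close>

lemma D_sasaki_form:
  assumes p: "fst p \<in> S"
  shows "D (\<lambda>q. sasaki_form q B C) p A =
    G (fst p) (\<Gamma> (fst p) (fst A) (fst B)) (fst C) + G (fst p) (fst B) (\<Gamma> (fst p) (fst A) (fst C)) +
    (G (fst p) (sasaki_vertical p A B + (1/2) *\<^sub>R R (fst p) (fst A) (fst B) (snd p)) (vertical p C) +
     G (fst p) (vertical p B) (sasaki_vertical p A C + (1/2) *\<^sub>R R (fst p) (fst A) (fst C) (snd p)))"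
proof -
  have v: "((\<lambda>q. vertical q B) has_derivative
      (\<lambda>A. D (\<lambda>y. \<Gamma> y (fst B) (snd p)) (fst p) (fst A) + \<Gamma> (fst p) (fst B) (snd A))) (at p)" for B
  proof -
    have "((\<lambda>q. snd B + \<Gamma> (fst q) (fst B) (snd q)) has_derivative
      (\<lambda>A. 0 + (D (\<lambda>y. \<Gamma> y (fst B) (snd p)) (fst p) (fst A) + \<Gamma> (fst p) 0 (snd p) + \<Gamma> (fst p) (fst B) (snd A)))) (at p)"
      by (intro has_derivative_add has_derivative_const
          has_derivative_bilinear_family[where \<phi> = fst and x = p, OF open_S p bilinear_\<Gamma> differentiable_\<Gamma>]
          has_derivative_fst has_derivative_snd has_derivative_ident p)
    then show ?thesis
      by (simp add: vertical_def bilinear_lzero[OF bilinear_\<Gamma>[OF p]])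
  qed
  have "((\<lambda>q. sasaki_form q B C) has_derivative (\<lambda>A.
    (G (fst p) (\<Gamma> (fst p) (fst A) (fst B) + 0) (fst C) + G (fst p) (fst B) (\<Gamma> (fst p) (fst A) (fst C) + 0)) +
    (G (fst p) (\<Gamma> (fst p) (fst A) (vertical p B) +
        (D (\<lambda>y. \<Gamma> y (fst B) (snd p)) (fst p) (fst A) + \<Gamma> (fst p) (fst B) (snd A))) (vertical p C) +
     G (fst p) (vertical p B) (\<Gamma> (fst p) (fst A) (vertical p C) +
        (D (\<lambda>y. \<Gamma> y (fst C) (snd p)) (fst p) (fst A) + \<Gamma> (fst p) (fst C) (snd A)))))) (at p)"
    unfolding sasaki_form_def
    by (intro has_derivative_add has_derivative_G_family p v has_derivative_fst has_derivative_ident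
        has_derivative_const)
  from D_eqI[OF this] show ?thesis
    by (simp add: sasaki_vertical_def algebra_simps)
qed

text \<open>By \<open>R_eq\<close>, exchanging \<open>A\<close> and \<open>B\<close> in the first
  three terms of \<open>sasaki_vertical\<close> changes them by R(A, B) \<xi>. Subtracting half of
  this skew term restores symmetry.\<close>

lemma sasaki_\<Gamma>_sym:
  assumes p: "fst p \<in> S"
  shows "sasaki_\<Gamma> p A B = sasaki_\<Gamma> p B A"
proof -
  have h: "sasaki_horizontal p A B = sasaki_horizontal p B A"
    using p by (simp add: sasaki_horizontal_def \<Gamma>_sym[of _ "fst A" "fst B"] add.commute)
  define r where "r = R (fst p) (fst A) (fst B) (snd p)"
  \<comment> \<open>The curvature is written as two halves so that each cancels against the
    correction term of one side.\<close>
  have D: "D (\<lambda>y. \<Gamma> y (fst B) (snd p)) (fst p) (fst A) = (1/2) *\<^sub>R r + (1/2) *\<^sub>R r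
      + D (\<lambda>y. \<Gamma> y (fst A) (snd p)) (fst p) (fst B)
      - \<Gamma> (fst p) (fst A) (\<Gamma> (fst p) (fst B) (snd p)) + \<Gamma> (fst p) (fst B) (\<Gamma> (fst p) (fst A) (snd p))"
    unfolding r_def R_eq[OF p] by (simp flip: scaleR_add_left)
  have r: "R (fst p) (fst B) (fst A) (snd p) = - r"
    unfolding r_def by (rule R_skew[OF p])
  have "sasaki_vertical p A B = sasaki_vertical p B A"
    unfolding sasaki_vertical_def vertical_def \<Gamma>_simps[OF p] r r_def[symmetric] unfolding D
    by simp
  with h show ?thesis
    by (simp add: sasaki_\<Gamma>_def)
qed

lemma bilinear_sasaki_\<Gamma>:
  assumes p: "fst p \<in> S"
  shows "bilinear (sasaki_\<Gamma> p)"
proof (rule bilinear_symI[OF sasaki_\<Gamma>_sym[OF p]])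
  fix A
  note v = linear_add[OF linear_vertical[OF p]] linear_scale[OF linear_vertical[OF p]]
  have h: "linear (sasaki_horizontal p A)"
    by (rule linearI) (simp_all add: sasaki_horizontal_def v R_simps[OF p] \<Gamma>_simps[OF p] scaleR_add_right)
  have w: "linear (sasaki_vertical p A)"
    by (rule linearI) (simp_all add: sasaki_vertical_def v R_simps[OF p] \<Gamma>_simps[OF p] D\<Gamma>_simps[OF p]
        scaleR_add_right scaleR_diff_right)
  show "linear (sasaki_\<Gamma> p A)"
    by (rule linearI) (simp_all add: sasaki_\<Gamma>_def linear_add[OF h] linear_scale[OF h] linear_add[OF w]
        linear_scale[OF w] \<Gamma>_simps[OF p] scaleR_diff_right)
qed

text \<open>Against \<open>D_sasaki_form\<close>, the horizontal terms R(\<xi>, K A) cancel each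
  other by skewness with respect to the metric. The terms R(\<xi>, K B) A and R(\<xi>, K C) A
  balance the vertical halves of the curvature by pair symmetry.\<close>

lemma levi_civita_sasaki:
  assumes p: "fst p \<in> S"
  shows "levi_civita sasaki_form p (sasaki_\<Gamma> p)"
  unfolding levi_civita_def
proof (intro conjI allI bilinear_sasaki_\<Gamma> sasaki_\<Gamma>_sym p)
  fix A B C :: "'e \<times> 'e"
  define x \<xi> where "x = fst p" and "\<xi> = snd p"
  have x: "x \<in> S"
    using p by (simp add: x_def)
  have skew: "G x (R x \<xi> (vertical p A) (fst B)) (fst C) = - G x (fst B) (R x \<xi> (vertical p A) (fst C))"
    by (rule R_metric_skew[OF x])
  have pair1: "G x (R x \<xi> (vertical p B) (fst A)) (fst C) = G x (R x (fst A) (fst C) \<xi>) (vertical p B)" for B C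
    by (rule R_pair_sym[OF x])
  show "D (\<lambda>q. sasaki_form q B C) p A = sasaki_form p (sasaki_\<Gamma> p A B) C + sasaki_form p B (sasaki_\<Gamma> p A C)"
    using skew pair1[of B C] pair1[of C B]
    unfolding D_sasaki_form[OF p]
    unfolding sasaki_form_def vertical_sasaki_\<Gamma>
    unfolding x_def[symmetric] \<xi>_def[symmetric]
    by (simp add: sasaki_\<Gamma>_def sasaki_horizontal_def x G_simps
        G_sym[OF x, of "vertical p B"] G_sym[OF x, of "fst B"] add_divide_distrib diff_divide_distrib
        flip: x_def \<xi>_def)
qed

lemma christoffel_form_sasaki: "fst p \<in> S \<Longrightarrow> christoffel_form sasaki_form p = sasaki_\<Gamma> p"
  by (intro christoffel_form_eqI inner_form_sasaki levi_civita_sasaki)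

text \<open>The defect \<open>E\<close> of the law is symmetric in \<open>u\<close>,
  \<open>v\<close> since second derivatives of \<tau> commute. Differentiating the isometry identity
  makes its pairing with \<open>D \<tau> x w\<close> skew in \<open>v\<close>, \<open>w\<close>, so
  it vanishes as in the proof of uniqueness.\<close>

lemma \<Gamma>_transform:
  fixes \<tau> :: "'e \<Rightarrow> 'e"
  assumes "coordinate_metric S' G'" "open T" "x \<in> T" "T \<subseteq> S" "smooth_on T \<tau>" "\<tau> ` T \<subseteq> S'"
    and iso: "\<And>y u v. y \<in> T \<Longrightarrow> G y u v = G' (\<tau> y) (D \<tau> y u) (D \<tau> y v)"
  shows "D \<tau> x (\<Gamma> x u v) = christoffel_form G' (\<tau> x) (D \<tau> x u) (D \<tau> x v) + D (\<lambda>y. D \<tau> y v) x u"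
proof -
  interpret N: coordinate_metric S' G' by fact
  have x: "x \<in> S" and tx: "\<tau> x \<in> S'"
    using assms by auto
  have lin: "linear (D \<tau> x)"
    using assms smooth_on_linear by blast
  \<comment> \<open>A linear isometry of a definite form is injective, hence surjective here; thus
    \<open>D \<tau> x w\<close> below ranges over all vectors.\<close>
  have "inj (D \<tau> x)"
    unfolding linear_injective_0[OF lin]
  proof (intro allI impI)
    fix u assume "D \<tau> x u = 0"
    then have "G x u u = 0"
      using iso[OF \<open>x \<in> T\<close>] bilinear_lzero[OF N.bilinear_G[OF tx]] by simp
    then show "u = 0"
      using inner_form_G[OF x] unfolding inner_form_def by (metis less_irrefl)
  qed
  then have surj: "surj (D \<tau> x)"
    by (rule linear_inj_imp_surj[OF lin])
  define E where "E u v = D \<tau> x (\<Gamma> x u v) - (N.\<Gamma> (\<tau> x) (D \<tau> x u) (D \<tau> x v) + D (\<lambda>y. D \<tau> y v) x u)" for u v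
  have "G' (\<tau> x) (E u v) (D \<tau> x w) = 0" for w
  proof (rule symmetric_skew_eq_0[of "\<lambda>u v w. G' (\<tau> x) (E u v) (D \<tau> x w)"])
    fix u v w
    have "E u v = E v u"
      using \<Gamma>_sym[OF x, of u v] N.\<Gamma>_sym[OF tx, of "D \<tau> x u" "D \<tau> x v"] D_D_commute[OF assms(2,3,5), of u v]
      by (simp add: E_def)
    then show "G' (\<tau> x) (E u v) (D \<tau> x w) = G' (\<tau> x) (E v u) (D \<tau> x w)"
      by simp
    have "D (\<lambda>y. G y v w) x u = D (\<lambda>y. G' (\<tau> y) (D \<tau> y v) (D \<tau> y w)) x u"
      by (rule fun_cong[OF D_cong[OF assms(2,3)]]) (simp add: iso)
    also have "\<dots> =
        G' (\<tau> x) (N.\<Gamma> (\<tau> x) (D \<tau> x u) (D \<tau> x v) + D (\<lambda>y. D \<tau> y v) x u) (D \<tau> x w) +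
        G' (\<tau> x) (D \<tau> x v) (N.\<Gamma> (\<tau> x) (D \<tau> x u) (D \<tau> x w) + D (\<lambda>y. D \<tau> y w) x u)"
      by (simp only: D_eqI[OF N.has_derivative_G_family[where \<phi> = \<tau> and x = x, OF tx
            smooth_on_has_derivative[OF assms(5,3)]
            smooth_on_has_derivative[OF smooth_on_D[OF assms(5)] assms(3)]
            smooth_on_has_derivative[OF smooth_on_D[OF assms(5)] assms(3)]]])
    finally have "G' (\<tau> x) (E u v) (D \<tau> x w) + G' (\<tau> x) (D \<tau> x v) (E u w) = 0"
      unfolding D_G[OF x] iso[OF \<open>x \<in> T\<close>] by (simp add: E_def N.G_simps tx)
    then show "G' (\<tau> x) (E u v) (D \<tau> x w) = - G' (\<tau> x) (E u w) (D \<tau> x v)"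
      using N.G_sym[OF tx] by (smt (verit))
  qed
  then have "G' (\<tau> x) (E u v) w = 0" for w
    using surj by (metis surjD)
  then have "E u v = 0"
    using inner_form_nondegenerate[OF N.inner_form_G[OF tx]] by blast
  then show ?thesis
    by (simp add: E_def)
qed

end

section \<open>The Sasaki metric in the charts of the tangent bundle\<close>

lemma christoffel_form_cong:
  assumes "open S" "x \<in> S" "\<And>y. y \<in> S \<Longrightarrow> G y = G' y"
  shows "christoffel_form G x = christoffel_form G' x"
proof -
  have "D (\<lambda>y. G y u v) x = D (\<lambda>y. G' y u v) x" for u v
    by (rule D_cong[OF assms(1,2)]) (simp add: assms(3))
  then show ?thesis
    using assms(2,3) by (simp add: christoffel_form_def levi_civita_def)
qed

section \<open>Tangent vectors and directional derivatives in charts\<close>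

lemma tangent_spaceD:
  assumes "w \<in> tangent_space A p"
  shows "fst w = p"
    "c \<in> charts_at A p \<Longrightarrow> c' \<in> charts_at A p \<Longrightarrow>
      snd w c' = D (snd c' \<circ> chart_inv c) (snd c p) (snd w c)"
    "c \<notin> charts_at A p \<Longrightarrow> snd w c = 0"
  using assms unfolding tangent_space_def by blast+

text \<open>One derivative of the transition maps is enough for tangent vectors and
  \<open>dir_deriv\<close>. At this level of generality the lemmas serve the base and the tangent
  bundle alike.\<close>

locale diff_atlas =
  fixes A :: "('a, 'e::euclidean_space) atlas"
  assumes inj_chart: "c \<in> A \<Longrightarrow> inj_on (snd c) (fst c)"
    and open_overlap: "c \<in> A \<Longrightarrow> c' \<in> A \<Longrightarrow> open (snd c ` (fst c \<inter> fst c'))"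
    and differentiable_transition: "c \<in> A \<Longrightarrow> c' \<in> A \<Longrightarrow> x \<in> snd c ` (fst c \<inter> fst c') \<Longrightarrow>
      (snd c' \<circ> chart_inv c) differentiable (at x)"
begin

lemma charts_atD: "c \<in> charts_at A p \<Longrightarrow> c \<in> A" "c \<in> charts_at A p \<Longrightarrow> p \<in> fst c"
  by (auto simp: charts_at_def)

lemma chart_inv_chart: "c \<in> A \<Longrightarrow> p \<in> fst c \<Longrightarrow> chart_inv c (snd c p) = p"
  using inj_chart by (simp add: chart_inv_def)

lemma chart_chart_inv: "x \<in> snd c ` fst c \<Longrightarrow> snd c (chart_inv c x) = x"
  by (simp add: chart_inv_def f_inv_into_f)

lemma chart_inv_in: "x \<in> snd c ` fst c \<Longrightarrow> chart_inv c x \<in> fst c"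
  by (simp add: chart_inv_def inv_into_into)

lemma open_chart: "c \<in> A \<Longrightarrow> open (snd c ` fst c)"
  using open_overlap[of c c] by simp

lemma chart_in: "c \<in> charts_at A p \<Longrightarrow> snd c p \<in> snd c ` fst c"
  by (simp add: charts_at_def)

lemma in_overlap: "c \<in> charts_at A p \<Longrightarrow> c' \<in> charts_at A p \<Longrightarrow> snd c p \<in> snd c ` (fst c \<inter> fst c')"
  by (simp add: charts_at_def)

lemma has_derivative_change_of_chart:
  assumes c: "c \<in> charts_at A p" "c' \<in> charts_at A p"
    and h: "(h \<circ> chart_inv c') differentiable (at (snd c' p))"
  shows "((h \<circ> chart_inv c) has_derivative
    (\<lambda>u. D (h \<circ> chart_inv c') (snd c' p) (D (snd c' \<circ> chart_inv c) (snd c p) u))) (at (snd c p))"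
proof -
  note cA = charts_atD[OF c(1)] charts_atD[OF c(2)]
  have 1: "(snd c' \<circ> chart_inv c) (snd c p) = snd c' p"
    by (simp add: chart_inv_chart cA)
  have "((snd c' \<circ> chart_inv c) has_derivative D (snd c' \<circ> chart_inv c) (snd c p)) (at (snd c p))"
    using differentiable_transition cA in_overlap[OF c] frechet_derivative_works by blast
  moreover have "((h \<circ> chart_inv c') has_derivative D (h \<circ> chart_inv c') (snd c' p))
      (at ((snd c' \<circ> chart_inv c) (snd c p)))"
    using h unfolding 1 by (simp add: frechet_derivative_works)
  ultimately have "((\<lambda>x. (h \<circ> chart_inv c') ((snd c' \<circ> chart_inv c) x)) has_derivative
    (\<lambda>u. D (h \<circ> chart_inv c') (snd c' p) (D (snd c' \<circ> chart_inv c) (snd c p) u))) (at (snd c p))"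
    by (rule has_derivative_compose)
  then show ?thesis
    \<comment> \<open>The composite through \<open>c'\<close> agrees with
      \<open>h \<circ> chart_inv c\<close> on the overlap, an open neighbourhood of the
      point.\<close>
    by (rule has_derivative_transform_within_open[OF _ open_overlap in_overlap[OF c]])
      (use cA in \<open>auto simp: chart_inv_chart\<close>)
qed

lemma D_transition_self:
  assumes c: "c \<in> charts_at A p"
  shows "D (snd c \<circ> chart_inv c) (snd c p) = (\<lambda>u. u)"
proof -
  have "D (snd c \<circ> chart_inv c) (snd c p) = D (\<lambda>x. x) (snd c p)"
    by (rule D_cong[OF open_chart chart_in]) (use c charts_atD in \<open>auto simp: chart_chart_inv\<close>)
  then show ?thesis by simp
qed

lemma linear_D_transition:
  assumes "c \<in> charts_at A p" "c' \<in> charts_at A p"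
  shows "linear (D (snd c' \<circ> chart_inv c) (snd c p))"
  by (rule linear_frechet_derivative)
    (rule differentiable_transition[OF charts_atD(1) charts_atD(1) in_overlap], (rule assms)+)

lemma tangent_vec_in_tangent_space:
  assumes c: "c \<in> charts_at A p"
  shows "tangent_vec A c p u \<in> tangent_space A p"
  unfolding tangent_space_def
proof (intro CollectI conjI ballI allI impI)
  fix c1 c2 assume cs: "c1 \<in> charts_at A p" "c2 \<in> charts_at A p"
  have "(snd c2 \<circ> chart_inv c1) differentiable (at (snd c1 p))"
    by (rule differentiable_transition[OF charts_atD(1) charts_atD(1) in_overlap], (rule cs)+)
  from D_eqI[OF has_derivative_change_of_chart[OF c cs(1) this]]
  show "snd (tangent_vec A c p u) c2 =
      D (snd c2 \<circ> chart_inv c1) (snd c1 p) (snd (tangent_vec A c p u) c1)"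
    using cs by (simp add: tangent_vec_def)
qed (auto simp: tangent_vec_def)

lemma tangent_vec_simps [simp]:
  "fst (tangent_vec A c p u) = p"
  "c \<in> charts_at A p \<Longrightarrow> snd (tangent_vec A c p u) c = u"
  by (simp_all add: tangent_vec_def D_transition_self)

lemma tangent_vec_component:
  assumes "w \<in> tangent_space A p" "c \<in> charts_at A p"
  shows "tangent_vec A c p (snd w c) = w"
proof (rule prod_eqI)
  show "fst (tangent_vec A c p (snd w c)) = fst w"
    using tangent_spaceD(1)[OF assms(1)] by (simp add: tangent_vec_def)
  show "snd (tangent_vec A c p (snd w c)) = snd w"
    using tangent_spaceD(2)[OF assms] tangent_spaceD(3)[OF assms(1)]
    by (auto simp: tangent_vec_def fun_eq_iff)
qed

lemma tangent_vec_add: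
  assumes "c \<in> charts_at A p"
  shows "tangent_vec A c p (u + v) = tadd (tangent_vec A c p u) (tangent_vec A c p v)"
  by (simp add: tangent_vec_def tadd_def fun_eq_iff linear_add[OF linear_D_transition[OF assms]]
      del: split_paired_All)

lemma tangent_vec_scale:
  assumes "c \<in> charts_at A p"
  shows "tangent_vec A c p (a *\<^sub>R u) = tscale a (tangent_vec A c p u)"
  by (simp add: tangent_vec_def tscale_def fun_eq_iff linear_scale[OF linear_D_transition[OF assms]]
      del: split_paired_All)

text \<open>\<open>dir_deriv\<close> picks an unspecified chart; by the chain rule and the
  transformation of components any chart around \<open>p\<close> gives the same value.\<close>

lemma dir_deriv_chart:
  assumes w: "w \<in> tangent_space A p" and c: "c \<in> charts_at A p"
    and h: "(h \<circ> chart_inv c) differentiable (at (snd c p))"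
  shows "dir_deriv A h w = D (h \<circ> chart_inv c) (snd c p) (snd w c)"
proof -
  define c0 where "c0 = (SOME c. c \<in> charts_at A p)"
  have c0: "c0 \<in> charts_at A p"
    using c someI[of "\<lambda>c. c \<in> charts_at A p"] by (simp add: c0_def)
  have "dir_deriv A h w = D (h \<circ> chart_inv c0) (snd c0 p) (snd w c0)"
    by (simp add: dir_deriv_def tangent_spaceD(1)[OF w] c0_def Let_def)
  also have "\<dots> = D (h \<circ> chart_inv c) (snd c p) (snd w c)"
    by (simp add: D_eqI[OF has_derivative_change_of_chart[OF c0 c h]] tangent_spaceD(2)[OF w c0 c])
  finally show ?thesis .
qed

end

locale smooth_atlas =
  fixes A :: "('a, 'e::euclidean_space) atlas"
  assumes smooth_inj_chart: "c \<in> A \<Longrightarrow> inj_on (snd c) (fst c)"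
    and smooth_open_overlap: "c \<in> A \<Longrightarrow> c' \<in> A \<Longrightarrow> open (snd c ` (fst c \<inter> fst c'))"
    and smooth_transition: "c \<in> A \<Longrightarrow> c' \<in> A \<Longrightarrow>
      smooth_on (snd c ` (fst c \<inter> fst c')) (snd c' \<circ> chart_inv c)"

sublocale smooth_atlas \<subseteq> diff_atlas
  using smooth_inj_chart smooth_open_overlap smooth_transition smooth_on_differentiable
  by unfold_locales blast+

lemma smooth_manifold_smooth_atlas: "smooth_manifold A \<Longrightarrow> smooth_atlas A"
  by (simp add: smooth_manifold_def smooth_atlas_def)

section \<open>The induced atlas of the tangent bundle\<close>

lemma in_induced_chart: "v \<in> fst (induced_chart A c) \<longleftrightarrow> fst v \<in> fst c \<and> v \<in> tangent_space A (fst v)"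
  by (auto simp: induced_chart_def dest: tangent_spaceD(1))

lemma induced_chart_apply: "snd (induced_chart A c) v = (snd c (fst v), snd v c)"
  by (simp add: induced_chart_def)

lemma in_pts_tangent_bundle:
  "v \<in> pts (tangent_bundle A) \<longleftrightarrow> fst v \<in> pts A \<and> v \<in> tangent_space A (fst v)"
  by (auto simp: pts_def tangent_bundle_def in_induced_chart)

lemma charts_at_tangent_bundle:
  "v \<in> tangent_space A p \<Longrightarrow> charts_at (tangent_bundle A) v = induced_chart A ` charts_at A p"
  using tangent_spaceD(1)[of v A p] by (auto simp: charts_at_def tangent_bundle_def in_induced_chart)

context smooth_atlas begin

lemma inj_on_induced_chart:
  assumes c: "c \<in> A"
  shows "inj_on (snd (induced_chart A c)) (fst (induced_chart A c))"
proof (rule inj_onI)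
  fix v w assume v: "v \<in> fst (induced_chart A c)" and w: "w \<in> fst (induced_chart A c)"
    and eq: "snd (induced_chart A c) v = snd (induced_chart A c) w"
  then have "fst v = fst w"
    using inj_chart[OF c] by (auto simp: in_induced_chart induced_chart_apply inj_on_def)
  moreover have "c \<in> charts_at A (fst v)"
    using v c by (simp add: in_induced_chart charts_at_def)
  ultimately show "v = w"
    using v w eq tangent_vec_component[of _ "fst v" c]
    by (metis in_induced_chart induced_chart_apply snd_conv)
qed

lemma chart_inv_induced_chart:
  assumes c: "c \<in> A" "x \<in> snd c ` fst c"
  shows "chart_inv (induced_chart A c) (x, u) = tangent_vec A c (chart_inv c x) u"
proof -
  define p where "p = chart_inv c x"
  have p: "c \<in> charts_at A p" "snd c p = x"
    using c by (auto simp: p_def charts_at_def chart_inv_in chart_chart_inv)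
  have "inj_on (snd (induced_chart A c)) (fst (induced_chart A c))"
    by (rule inj_on_induced_chart[OF c(1)])
  moreover have "tangent_vec A c p u \<in> fst (induced_chart A c)"
    using p charts_atD tangent_vec_in_tangent_space by (simp add: in_induced_chart)
  moreover have "snd (induced_chart A c) (tangent_vec A c p u) = (x, u)"
    using p by (simp add: induced_chart_apply)
  ultimately show ?thesis
    unfolding chart_inv_def[of "induced_chart A c"] p_def[symmetric] by (metis inv_into_f_f)
qed

lemma induced_chart_image:
  assumes "c \<in> A" "c' \<in> A"
  shows "snd (induced_chart A c) ` (fst (induced_chart A c) \<inter> fst (induced_chart A c')) =
    snd c ` (fst c \<inter> fst c') \<times> UNIV"
proof (intro equalityI subsetI)
  fix z assume "z \<in> snd (induced_chart A c) ` (fst (induced_chart A c) \<inter> fst (induced_chart A c'))"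
  then show "z \<in> snd c ` (fst c \<inter> fst c') \<times> UNIV"
    by (auto simp: in_induced_chart induced_chart_apply)
next
  fix z :: "'e \<times> 'e" assume "z \<in> snd c ` (fst c \<inter> fst c') \<times> UNIV"
  then obtain p where p: "p \<in> fst c" "p \<in> fst c'" "fst z = snd c p"
    by auto
  then have c: "c \<in> charts_at A p"
    using assms by (simp add: charts_at_def)
  show "z \<in> snd (induced_chart A c) ` (fst (induced_chart A c) \<inter> fst (induced_chart A c'))"
    using p c tangent_vec_in_tangent_space[OF c]
    by (intro image_eqI[of _ _ "tangent_vec A c p (snd z)"])
      (auto simp: in_induced_chart induced_chart_apply prod_eq_iff)
qed

lemma induced_transition:
  assumes "c \<in> A" "c' \<in> A" "x \<in> snd c ` (fst c \<inter> fst c')"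
  shows "(snd (induced_chart A c') \<circ> chart_inv (induced_chart A c)) (x, u) =
    ((snd c' \<circ> chart_inv c) x, D (snd c' \<circ> chart_inv c) x u)"
proof -
  obtain p where p: "x = snd c p" "p \<in> fst c" "p \<in> fst c'"
    using assms by auto
  then have "chart_inv c x = p" "x \<in> snd c ` fst c"
    using assms by (auto simp: chart_inv_chart)
  then show ?thesis
    using p assms by (simp add: chart_inv_induced_chart induced_chart_apply)
      (simp add: tangent_vec_def charts_at_def)
qed

text \<open>The transition map is the pair of \<tau> and its derivative, so the product rule adds a
  second derivative of \<tau>. This non-tensorial term is absorbed by the Christoffel symbols in the
  connection map.\<close>

lemma has_derivative_induced_transition:
  assumes c: "c \<in> A" "c' \<in> A" and x: "x \<in> snd c ` (fst c \<inter> fst c')"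
  shows "((snd (induced_chart A c') \<circ> chart_inv (induced_chart A c)) has_derivative
    (\<lambda>z. (D (snd c' \<circ> chart_inv c) x (fst z),
      D (\<lambda>y. D (snd c' \<circ> chart_inv c) y u) x (fst z) + D (snd c' \<circ> chart_inv c) x (snd z))))
    (at (x, u))"
proof -
  define \<tau> where "\<tau> = snd c' \<circ> chart_inv c"
  let ?T = "snd c ` (fst c \<inter> fst c')"
  have sm: "smooth_on ?T \<tau>" and op: "open ?T"
    using smooth_transition[OF c] open_overlap[OF c] by (auto simp: \<tau>_def)
  have op2: "open (?T \<times> (UNIV :: 'e set))"
    using op by (simp add: open_Times)
  have dfst: "((\<lambda>z. f (fst z)) has_derivative (\<lambda>z. D f x (fst z))) (at (x, u))"
    if "f differentiable (at x)" for f :: "'e \<Rightarrow> 'e"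
    by (rule has_derivative_compose[OF has_derivative_fst[OF has_derivative_ident]])
      (use that in \<open>simp add: frechet_derivative_works\<close>)
  have d2: "((\<lambda>z. D \<tau> (fst z) v) has_derivative (\<lambda>z. D (\<lambda>y. D \<tau> y v) x (fst z))) (at (x, u))" for v
    by (rule dfst[OF smooth_on_differentiable[OF smooth_on_D[OF sm] x]])
  have "\<forall>\<^sub>F z in nhds (x, u). linear (D \<tau> (fst z))"
    unfolding eventually_nhds using op2 x smooth_on_linear[OF sm]
    by (intro exI[of _ "?T \<times> UNIV"]) auto
  from has_derivative_linear_family[OF this _ has_derivative_snd[OF has_derivative_ident]]
  have "((\<lambda>z. D \<tau> (fst z) (snd z)) has_derivative
      (\<lambda>z. D (\<lambda>y. D \<tau> y u) x (fst z) + D \<tau> x (snd z))) (at (x, u))"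
    using d2 D_eqI[OF d2] by (force simp: differentiable_def)
  then have "((\<lambda>z. (\<tau> (fst z), D \<tau> (fst z) (snd z))) has_derivative
      (\<lambda>z. (D \<tau> x (fst z), D (\<lambda>y. D \<tau> y u) x (fst z) + D \<tau> x (snd z)))) (at (x, u))"
    by (intro has_derivative_Pair dfst smooth_on_differentiable[OF sm x])
  then show ?thesis
    unfolding \<tau>_def
    by (rule has_derivative_transform_within_open[OF _ op2])
      (use x induced_transition[OF c] in auto)
qed

sublocale TA: diff_atlas "tangent_bundle A"
proof
  fix c c' assume "c \<in> tangent_bundle A" "c' \<in> tangent_bundle A"
  then obtain b b' where b: "b \<in> A" "b' \<in> A" "c = induced_chart A b" "c' = induced_chart A b'"
    by (auto simp: tangent_bundle_def)
  show "open (snd c ` (fst c \<inter> fst c'))"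
    using b open_overlap by (simp add: induced_chart_image open_Times)
  show "(snd c' \<circ> chart_inv c) differentiable (at z)" if "z \<in> snd c ` (fst c \<inter> fst c')" for z
  proof (cases z)
    case (Pair x u)
    then have x: "x \<in> snd b ` (fst b \<inter> fst b')"
      using that unfolding b(3,4) induced_chart_image[OF b(1,2)] by simp
    show ?thesis
      using has_derivative_induced_transition[OF b(1,2) x, of u] Pair b(3,4)
      by (auto simp: differentiable_def)
  qed
next
  fix c assume "c \<in> tangent_bundle A"
  then obtain b where b: "b \<in> A" "c = induced_chart A b"
    by (auto simp: tangent_bundle_def)
  show "inj_on (snd c) (fst c)"
    unfolding b(2) by (rule inj_on_induced_chart[OF b(1)])
qed

lemma tangent_bundle_transform:
  assumes v: "v \<in> tangent_space A p" and V: "V \<in> tangent_space (tangent_bundle A) v"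
    and c: "c \<in> charts_at A p" "c' \<in> charts_at A p"
  defines "\<tau> \<equiv> snd c' \<circ> chart_inv c"
  shows "snd V (induced_chart A c') =
    (D \<tau> (snd c p) (fst (snd V (induced_chart A c))),
     D (\<lambda>y. D \<tau> y (snd v c)) (snd c p) (fst (snd V (induced_chart A c)))
       + D \<tau> (snd c p) (snd (snd V (induced_chart A c))))"
proof -
  have "snd V (induced_chart A c') =
      D (snd (induced_chart A c') \<circ> chart_inv (induced_chart A c)) (snd (induced_chart A c) v)
        (snd V (induced_chart A c))"
    using c by (intro tangent_spaceD(2)[OF V]) (simp_all add: charts_at_tangent_bundle[OF v])
  moreover have "snd (induced_chart A c) v = (snd c p, snd v c)"
    using tangent_spaceD(1)[OF v] by (simp add: induced_chart_apply)
  ultimately show ?thesis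
    using D_eqI[OF has_derivative_induced_transition[OF charts_atD(1) charts_atD(1) in_overlap[OF c]]] c
    by (simp add: \<tau>_def)
qed

lemma differential_projection:
  assumes v: "v \<in> tangent_space A p" and V: "V \<in> tangent_space (tangent_bundle A) v"
    and c: "c \<in> charts_at A p"
  shows "differential (tangent_bundle A) A fst V = tangent_vec A c p (fst (snd V (induced_chart A c)))"
proof -
  have [simp]: "fst V = v" "fst v = p"
    using tangent_spaceD(1)[OF v] tangent_spaceD(1)[OF V] by auto
  have "dir_deriv (tangent_bundle A) (snd c' \<circ> fst) V = fst (snd V (induced_chart A c'))"
    if c': "c' \<in> charts_at A p" for c'
  proof -
    note c'A = charts_atD[OF c']
    have iv: "snd (induced_chart A c') v \<in> snd c' ` fst c' \<times> UNIV"
      using c'A by (simp add: induced_chart_apply)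
    have op: "open (snd c' ` fst c' \<times> (UNIV :: 'e set))"
      using open_chart[OF c'A(1)] by (simp add: open_Times)
    have "((\<lambda>z. fst z) has_derivative (\<lambda>z. fst z)) (at (snd (induced_chart A c') v))"
      by (intro has_derivative_fst has_derivative_ident)
    then have d: "(snd c' \<circ> fst \<circ> chart_inv (induced_chart A c') has_derivative fst)
        (at (snd (induced_chart A c') v))"
      by (rule has_derivative_transform_within_open[OF _ op iv])
        (use c'A in \<open>auto simp: chart_inv_induced_chart chart_inv_chart\<close>)
    have ic: "induced_chart A c' \<in> charts_at (tangent_bundle A) v"
      using c' by (simp add: charts_at_tangent_bundle[OF v])
    from d have "snd c' \<circ> fst \<circ> chart_inv (induced_chart A c') differentiable (at (snd (induced_chart A c') v))"
      by (auto simp: differentiable_def)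
    from TA.dir_deriv_chart[OF V ic this] show ?thesis
      by (simp add: D_eqI[OF d])
  qed
  then show ?thesis
    using tangent_bundle_transform[OF v V c]
    by (auto simp: differential_def tangent_vec_def fun_eq_iff)
qed

end

section \<open>A Riemannian manifold and its Sasaki metric in charts\<close>

locale riemannian =
  fixes M :: "('a, 'e::euclidean_space) atlas" and g :: "('a, 'e) metric"
  assumes riemannian: "riemannian_manifold M g"

sublocale riemannian \<subseteq> smooth_atlas M
  by (rule smooth_manifold_smooth_atlas) (use riemannian in \<open>simp add: riemannian_manifold_def\<close>)

context riemannian begin

lemma coordinate_metric_chart:
  assumes c: "c \<in> M"
  shows "coordinate_metric (snd c ` fst c) (chart_metric M g c)"
proof
  show "open (snd c ` fst c)"
    by (rule open_chart[OF c])
  show "smooth_on (snd c ` fst c) (\<lambda>x. chart_metric M g c x u v)" for u v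
    using riemannian c by (simp add: riemannian_manifold_def)
  fix x assume "x \<in> snd c ` fst c"
  then obtain p where p: "c \<in> charts_at M p" "chart_inv c x = p"
    using c chart_inv_in[of x c] by (simp add: charts_at_def)
  let ?t = "tangent_vec M c p"
  have t: "?t u \<in> tangent_space M p" for u
    by (rule tangent_vec_in_tangent_space[OF p(1)])
  have "p \<in> pts M"
    using p(1) by (auto simp: charts_at_def pts_def)
  then have sym: "g (?t u) (?t v) = g (?t v) (?t u)"
    and add: "g (tadd (?t u) (?t v)) (?t w) = g (?t u) (?t w) + g (?t v) (?t w)"
    and scale: "g (tscale a (?t u)) (?t v) = a * g (?t u) (?t v)"
    and pos: "?t u \<noteq> (p, \<lambda>_. 0) \<Longrightarrow> g (?t u) (?t u) > 0" for u v w a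
    using riemannian t unfolding riemannian_manifold_def by blast+
  have sym': "chart_metric M g c x u v = chart_metric M g c x v u" for u v
    using sym by (simp add: chart_metric_def p(2))
  moreover have "bilinear (chart_metric M g c x)"
  proof (rule bilinear_symI[OF sym'])
    fix v
    have "linear (\<lambda>u. chart_metric M g c x u v)"
      by (rule linearI) (simp_all add: chart_metric_def p(2) tangent_vec_add[OF p(1)]
          tangent_vec_scale[OF p(1)] add scale)
    moreover have "(\<lambda>u. chart_metric M g c x u v) = chart_metric M g c x v"
      using sym' by (intro ext)
    ultimately show "linear (chart_metric M g c x v)"
      by simp
  qed
  moreover have "chart_metric M g c x u u > 0" if "u \<noteq> 0" for u
  proof -
    have "snd (?t u) c \<noteq> 0"
      using p(1) that by simp
    then have "?t u \<noteq> (p, \<lambda>_. 0)"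
      by (metis snd_conv)
    then show ?thesis
      using pos by (simp add: chart_metric_def p(2))
  qed
  ultimately show "inner_form (chart_metric M g c x)"
    by (simp add: inner_form_def)
qed

lemma metric_in_chart:
  assumes "v \<in> tangent_space M p" "w \<in> tangent_space M p" "c \<in> charts_at M p"
  shows "g v w = chart_metric M g c (snd c p) (snd v c) (snd w c)"
  using assms charts_atD[OF assms(3)]
  by (simp add: chart_metric_def chart_inv_chart tangent_vec_component)

lemma chart_metric_transform:
  assumes "c \<in> M" "c' \<in> M" and y: "y \<in> snd c ` (fst c \<inter> fst c')"
  shows "chart_metric M g c y u v = chart_metric M g c' ((snd c' \<circ> chart_inv c) y)
    (D (snd c' \<circ> chart_inv c) y u) (D (snd c' \<circ> chart_inv c) y v)"
proof -
  obtain p where p: "y = snd c p" "p \<in> fst c" "p \<in> fst c'"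
    using y by auto
  then have c: "c \<in> charts_at M p" "c' \<in> charts_at M p" "chart_inv c y = p"
    using assms by (auto simp: charts_at_def chart_inv_chart)
  have "chart_metric M g c y u v = g (tangent_vec M c p u) (tangent_vec M c p v)"
    by (simp add: chart_metric_def c)
  also have "\<dots> = chart_metric M g c' (snd c' p)
      (snd (tangent_vec M c p u) c') (snd (tangent_vec M c p v) c')"
    by (intro metric_in_chart tangent_vec_in_tangent_space c)
  finally show ?thesis
    using c p by (simp add: tangent_vec_def)
qed

lemma christoffel_transform:
  assumes c: "c \<in> charts_at M p" "c' \<in> charts_at M p"
  defines "\<tau> \<equiv> snd c' \<circ> chart_inv c"
  shows "D \<tau> (snd c p) (christoffel M g c (snd c p) u v) =
    christoffel M g c' (snd c' p) (D \<tau> (snd c p) u) (D \<tau> (snd c p) v) + D (\<lambda>y. D \<tau> y v) (snd c p) u"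
proof -
  note cM = charts_atD[OF c(1)] charts_atD[OF c(2)]
  interpret C: coordinate_metric "snd c ` fst c" "chart_metric M g c"
    by (rule coordinate_metric_chart[OF cM(1)])
  have "\<tau> (snd c p) = snd c' p"
    using cM by (simp add: \<tau>_def chart_inv_chart)
  moreover have "\<tau> ` (snd c ` (fst c \<inter> fst c')) \<subseteq> snd c' ` fst c'"
    using cM by (auto simp: \<tau>_def chart_inv_chart)
  ultimately show ?thesis
    using C.\<Gamma>_transform[OF coordinate_metric_chart[OF cM(3)] open_overlap[OF cM(1,3)] in_overlap[OF c] _
        smooth_transition[OF cM(1,3), folded \<tau>_def], of u v]
      chart_metric_transform[OF cM(1,3), folded \<tau>_def]
    unfolding christoffel_eq_christoffel_form by auto
qed

text \<open>\<open>connection_map\<close> is computed separately in each chart, while the axioms for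
  \<open>g\<close> concern tangent vectors only. The components fit together because the second
  derivatives in \<open>tangent_bundle_transform\<close> and \<open>christoffel_transform\<close>
  match.\<close>

lemma connection_map_in_chart:
  assumes v: "v \<in> tangent_space M p" and V: "V \<in> tangent_space (tangent_bundle M) v"
    and c: "c \<in> charts_at M p"
  shows "connection_map M g V = tangent_vec M c p (snd (snd V (induced_chart M c)) +
    christoffel M g c (snd c p) (fst (snd V (induced_chart M c))) (snd v c))"
proof -
  have [simp]: "fst V = v" "fst v = p"
    using tangent_spaceD(1)[OF v] tangent_spaceD(1)[OF V] by auto
  define a b where "a = fst (snd V (induced_chart M c))" and "b = snd (snd V (induced_chart M c))"
  have "snd (snd V (induced_chart M c')) +
      christoffel M g c' (snd c' p) (fst (snd V (induced_chart M c'))) (snd v c') =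
      D (snd c' \<circ> chart_inv c) (snd c p) (b + christoffel M g c (snd c p) a (snd v c))"
    if c': "c' \<in> charts_at M p" for c'
  proof -
    have "snd v c' = D (snd c' \<circ> chart_inv c) (snd c p) (snd v c)"
      by (rule tangent_spaceD(2)[OF v c c'])
    then show ?thesis
      using tangent_bundle_transform[OF v V c c'] linear_add[OF linear_D_transition[OF c c']]
        christoffel_transform[OF c c'] by (simp add: a_def b_def)
  qed
  then show ?thesis
    by (auto simp: connection_map_def tangent_vec_def fun_eq_iff a_def b_def case_prod_beta)
qed

lemma sasaki_chart_metric:
  assumes c: "c \<in> M" "x \<in> snd c ` fst c"
  shows "chart_metric (tangent_bundle M) (sasaki_metric M g) (induced_chart M c) (x, u) =
    coordinate_metric.sasaki_form (chart_metric M g c) (x, u)"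
proof (intro ext)
  fix Z W
  interpret C: coordinate_metric "snd c ` fst c" "chart_metric M g c"
    by (rule coordinate_metric_chart[OF c(1)])
  define p where "p = chart_inv c x"
  have p: "c \<in> charts_at M p" "snd c p = x"
    using c by (auto simp: p_def charts_at_def chart_inv_in chart_chart_inv)
  define v where "v = tangent_vec M c p u"
  have v: "v \<in> tangent_space M p"
    by (simp add: v_def tangent_vec_in_tangent_space p)
  have ic: "induced_chart M c \<in> charts_at (tangent_bundle M) v"
    using p by (simp add: charts_at_tangent_bundle[OF v])
  define t where "t Z = tangent_vec (tangent_bundle M) (induced_chart M c) v Z" for Z
  have t: "t Z \<in> tangent_space (tangent_bundle M) v" "snd (t Z) (induced_chart M c) = Z" for Z
    unfolding t_def using ic by (auto simp: TA.tangent_vec_in_tangent_space)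
  have m: "g (tangent_vec M c p a) (tangent_vec M c p b) = chart_metric M g c x a b" for a b
    by (simp add: chart_metric_def p_def)
  show "chart_metric (tangent_bundle M) (sasaki_metric M g) (induced_chart M c) (x, u) Z W =
      C.sasaki_form (x, u) Z W"
    unfolding chart_metric_def[of "tangent_bundle M"] chart_inv_induced_chart[OF c]
      p_def[symmetric] v_def[symmetric] t_def[symmetric] sasaki_metric_def
      differential_projection[OF v t(1) p(1)] connection_map_in_chart[OF v t(1) p(1)] t(2) p(2) m
      C.sasaki_form_def C.vertical_def christoffel_eq_christoffel_form
    using p(1) by (simp add: v_def)
qed

text \<open>The chart expression of the Sasaki metric equals \<open>sasaki_form\<close> on the whole
  open image of the induced chart, so the derivatives in the two descriptions agree as well.\<close>

lemma christoffel_sasaki: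
  assumes c: "c \<in> M" "x \<in> snd c ` fst c"
  shows "christoffel (tangent_bundle M) (sasaki_metric M g) (induced_chart M c) (x, u) =
    coordinate_metric.sasaki_\<Gamma> (chart_metric M g c) (x, u)"
proof -
  interpret C: coordinate_metric "snd c ` fst c" "chart_metric M g c"
    by (rule coordinate_metric_chart[OF c(1)])
  have "christoffel_form (chart_metric (tangent_bundle M) (sasaki_metric M g) (induced_chart M c)) (x, u) =
      christoffel_form C.sasaki_form (x, u)"
    by (rule christoffel_form_cong[of "snd c ` fst c \<times> UNIV"])
      (use c C.open_S sasaki_chart_metric[OF c(1)] in \<open>auto simp: open_Times\<close>)
  then show ?thesis
    using C.christoffel_form_sasaki c by (simp add: christoffel_eq_christoffel_form)
qed

end

section \<open>Vector fields along a submanifold in charts\<close>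

lemma smooth_on_transform:
  assumes "smooth_on S f" "open S" "\<And>x. x \<in> S \<Longrightarrow> h x = f x"
  shows "smooth_on S h"
  using assms smooth_on_cong[of S h f] by blast

text \<open>Since \<eta> preserves base points, the preimage of an induced chart domain is the
  domain of the base chart; this removes \<eta> from the sets on which smoothness is
  required.\<close>

lemma vector_field_along_iff:
  assumes "pts F \<subseteq> pts M"
  shows "vector_field_along M F \<eta> \<longleftrightarrow> (\<forall>p\<in>pts F. \<eta> p \<in> tangent_space M p) \<and>
    (\<forall>c\<in>F. \<forall>c'\<in>M. open (snd c ` (fst c \<inter> fst c')) \<and>
      smooth_on (snd c ` (fst c \<inter> fst c')) (\<lambda>x. snd (induced_chart M c') (\<eta> (chart_inv c x))))"
proof -
  have 1: "\<eta> ` pts F \<subseteq> pts (tangent_bundle M) \<and> (\<forall>p\<in>pts F. fst (\<eta> p) = p) \<longleftrightarrow>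
      (\<forall>p\<in>pts F. \<eta> p \<in> tangent_space M p)"
  proof -
    have "\<eta> p \<in> pts (tangent_bundle M) \<and> fst (\<eta> p) = p \<longleftrightarrow> \<eta> p \<in> tangent_space M p" if "p \<in> pts F" for p
      using that assms tangent_spaceD(1)[of "\<eta> p" M p] by (auto simp: in_pts_tangent_bundle)
    then show ?thesis
      by blast
  qed
  have 2: "fst c \<inter> \<eta> -` fst (induced_chart M c') = fst c \<inter> fst c'"
    if "\<forall>p\<in>pts F. \<eta> p \<in> tangent_space M p" "c \<in> F" for c c'
  proof -
    have "\<eta> p \<in> tangent_space M p" "fst (\<eta> p) = p" if "p \<in> fst c" for p
      using that \<open>c \<in> F\<close> \<open>\<forall>p\<in>pts F. \<eta> p \<in> tangent_space M p\<close>
      by (auto simp: pts_def dest: tangent_spaceD(1))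
    then have "\<eta> p \<in> fst (induced_chart M c') \<longleftrightarrow> p \<in> fst c'" if "p \<in> fst c" for p
      using that by (simp add: in_induced_chart)
    then show ?thesis
      by blast
  qed
  have 3: "(\<forall>c\<in>F. \<forall>c'\<in>tangent_bundle M. open (snd c ` (fst c \<inter> \<eta> -` fst c')) \<and>
        smooth_on (snd c ` (fst c \<inter> \<eta> -` fst c')) (snd c' \<circ> \<eta> \<circ> chart_inv c)) \<longleftrightarrow>
      (\<forall>c\<in>F. \<forall>c'\<in>M. open (snd c ` (fst c \<inter> fst c')) \<and>
        smooth_on (snd c ` (fst c \<inter> fst c')) (\<lambda>x. snd (induced_chart M c') (\<eta> (chart_inv c x))))"
    if "\<forall>p\<in>pts F. \<eta> p \<in> tangent_space M p"
    by (simp add: tangent_bundle_def 2[OF that] comp_def cong: ball_cong)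
  show ?thesis
    unfolding vector_field_along_def smooth_map_def using 1 3 by blast
qed

lemma vector_field_along_in_tangent_space:
  "vector_field_along M F \<eta> \<Longrightarrow> p \<in> pts F \<Longrightarrow> \<eta> p \<in> tangent_space M p"
  unfolding vector_field_along_def smooth_map_def using in_pts_tangent_bundle[of "\<eta> p" M]
  by (metis image_subset_iff)

section \<open>Tangent fields of the image of a vector field\<close>

definition image_chart :: "('a \<Rightarrow> ('a, 'e) tvec) \<Rightarrow> ('a, 'd) chart \<Rightarrow> (('a, 'e) tvec, 'd) chart" where
  "image_chart \<xi> d = (\<xi> ` fst d, snd d \<circ> fst)"

lemma field_image_eq: "field_image \<xi> F = image_chart \<xi> ` F"
  by (simp add: field_image_def image_chart_def)

text \<open>A section is injective with inverse \<open>fst\<close>. Hence the transported atlas has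
  the same chart images and transition maps as \<open>F\<close>.\<close>

locale section_atlas = F: smooth_atlas F
  for F :: "('a, 'd::euclidean_space) atlas" +
  fixes \<xi> :: "'a \<Rightarrow> ('a, 'e::euclidean_space) tvec"
  assumes fst_section: "p \<in> pts F \<Longrightarrow> fst (\<xi> p) = p"
begin

lemma fst_section': "d \<in> F \<Longrightarrow> p \<in> fst d \<Longrightarrow> fst (\<xi> p) = p"
  using fst_section by (auto simp: pts_def)

lemma image_chart_apply: "d \<in> F \<Longrightarrow> p \<in> fst d \<Longrightarrow> snd (image_chart \<xi> d) (\<xi> p) = snd d p"
  by (simp add: image_chart_def fst_section')

lemma in_image_chart: "d \<in> F \<Longrightarrow> p \<in> pts F \<Longrightarrow> \<xi> p \<in> fst (image_chart \<xi> d) \<longleftrightarrow> p \<in> fst d"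
proof
  assume dp: "d \<in> F" "p \<in> pts F"
  assume "\<xi> p \<in> fst (image_chart \<xi> d)"
  then obtain q where "q \<in> fst d" "\<xi> p = \<xi> q"
    by (auto simp: image_chart_def)
  then show "p \<in> fst d"
    using fst_section[OF dp(2)] fst_section'[OF dp(1)] by metis
qed (simp add: image_chart_def)

lemma image_chart_overlap:
  assumes "d \<in> F" "d' \<in> F"
  shows "snd (image_chart \<xi> d) ` (fst (image_chart \<xi> d) \<inter> fst (image_chart \<xi> d')) = snd d ` (fst d \<inter> fst d')"
proof -
  have 1: "fst (image_chart \<xi> d) \<inter> fst (image_chart \<xi> d') = \<xi> ` (fst d \<inter> fst d')"
  proof
    show "fst (image_chart \<xi> d) \<inter> fst (image_chart \<xi> d') \<subseteq> \<xi> ` (fst d \<inter> fst d')"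
    proof
      fix v assume "v \<in> fst (image_chart \<xi> d) \<inter> fst (image_chart \<xi> d')"
      then obtain p q where "p \<in> fst d" "q \<in> fst d'" "v = \<xi> p" "v = \<xi> q"
        by (auto simp: image_chart_def)
      moreover from this have "p = q"
        using fst_section' assms by metis
      ultimately show "v \<in> \<xi> ` (fst d \<inter> fst d')"
        by blast
    qed
  qed (auto simp: image_chart_def)
  show "snd (image_chart \<xi> d) ` (fst (image_chart \<xi> d) \<inter> fst (image_chart \<xi> d')) = snd d ` (fst d \<inter> fst d')"
    unfolding 1 image_image using assms by (intro image_cong) (auto simp: image_chart_apply)
qed

lemma chart_inv_image_chart:
  assumes d: "d \<in> F" "y \<in> snd d ` fst d"
  shows "chart_inv (image_chart \<xi> d) y = \<xi> (chart_inv d y)"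
proof -
  have "inj_on (snd (image_chart \<xi> d)) (fst (image_chart \<xi> d))"
    using F.inj_chart[OF d(1)] d(1) by (auto simp: image_chart_def inj_on_def fst_section')
  moreover have "\<xi> (chart_inv d y) \<in> fst (image_chart \<xi> d)"
    using F.chart_inv_in[OF d(2)] by (simp add: image_chart_def)
  moreover have "snd (image_chart \<xi> d) (\<xi> (chart_inv d y)) = y"
    using d by (simp add: image_chart_apply F.chart_inv_in F.chart_chart_inv)
  ultimately show ?thesis
    unfolding chart_inv_def[of "image_chart \<xi> d"] by (metis inv_into_f_f)
qed

lemma image_transition:
  assumes "d \<in> F" "d' \<in> F" "y \<in> snd d ` (fst d \<inter> fst d')"
  shows "(snd (image_chart \<xi> d') \<circ> chart_inv (image_chart \<xi> d)) y = (snd d' \<circ> chart_inv d) y"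
proof -
  have "y \<in> snd d ` fst d" "chart_inv d y \<in> fst d'"
    using assms by (auto simp: F.chart_inv_chart)
  then show ?thesis
    using assms by (simp add: chart_inv_image_chart image_chart_apply)
qed

sublocale I: smooth_atlas "field_image \<xi> F"
proof
  fix e e' assume "e \<in> field_image \<xi> F" "e' \<in> field_image \<xi> F"
  then obtain d d' where d: "d \<in> F" "d' \<in> F" "e = image_chart \<xi> d" "e' = image_chart \<xi> d'"
    by (auto simp: field_image_eq)
  show "open (snd e ` (fst e \<inter> fst e'))"
    unfolding d(3,4) image_chart_overlap[OF d(1,2)] by (rule F.open_overlap[OF d(1,2)])
  show "smooth_on (snd e ` (fst e \<inter> fst e')) (snd e' \<circ> chart_inv e)"
    unfolding d(3,4) image_chart_overlap[OF d(1,2)]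
    by (rule smooth_on_transform[OF F.smooth_transition[OF d(1,2)] F.open_overlap[OF d(1,2)]])
      (rule image_transition[OF d(1,2)])
next
  fix e assume "e \<in> field_image \<xi> F"
  then obtain d where d: "d \<in> F" "e = image_chart \<xi> d"
    by (auto simp: field_image_eq)
  show "inj_on (snd e) (fst e)"
    using F.inj_chart[OF d(1)] d by (auto simp: image_chart_def inj_on_def fst_section')
qed

lemma pts_field_image: "pts (field_image \<xi> F) = \<xi> ` pts F"
  by (auto simp: pts_def field_image_eq image_chart_def)

lemma charts_at_field_image:
  "p \<in> pts F \<Longrightarrow> charts_at (field_image \<xi> F) (\<xi> p) = image_chart \<xi> ` charts_at F p"
  using in_image_chart by (auto simp: charts_at_def field_image_eq)

text \<open>The differentials of \<xi> and of the projection, between \<open>F\<close> and the image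
  with its own manifold structure. In the charts \<open>d\<close> and
  \<open>image_chart \<xi> d\<close> both leave components unchanged.\<close>

abbreviation lift :: "('a, 'd) tvec \<Rightarrow> (('a, 'e) tvec, 'd) tvec" where
  "lift \<equiv> differential F (field_image \<xi> F) \<xi>"

abbreviation unlift :: "(('a, 'e) tvec, 'd) tvec \<Rightarrow> ('a, 'd) tvec" where
  "unlift \<equiv> differential (field_image \<xi> F) F fst"

lemma charts_at_pts: "d \<in> charts_at F p \<Longrightarrow> p \<in> pts F"
  by (auto simp: charts_at_def pts_def)

lemma image_chart_at: "d \<in> charts_at F p \<Longrightarrow> image_chart \<xi> d \<in> charts_at (field_image \<xi> F) (\<xi> p)"
  by (simp add: charts_at_field_image charts_at_pts)

lemma lift_component:
  assumes w: "w \<in> tangent_space F p" and d: "d \<in> charts_at F p"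
  shows "snd (lift w) (image_chart \<xi> d) = snd w d"
proof -
  note dF = F.charts_atD[OF d]
  have "((\<lambda>y. y) has_derivative (\<lambda>y. y)) (at (snd d p))"
    by (rule has_derivative_ident)
  then have *: "((snd (image_chart \<xi> d) \<circ> \<xi>) \<circ> chart_inv d has_derivative (\<lambda>y. y)) (at (snd d p))"
    by (rule has_derivative_transform_within_open[OF _ F.open_chart[OF dF(1)] F.chart_in[OF d]])
      (use dF in \<open>auto simp: F.chart_inv_chart image_chart_apply\<close>)
  then have "dir_deriv F (snd (image_chart \<xi> d) \<circ> \<xi>) w = snd w d"
    using F.dir_deriv_chart[OF w d, of "snd (image_chart \<xi> d) \<circ> \<xi>"] D_eqI[OF *]
    by (auto simp: differentiable_def)
  then show ?thesis
    using image_chart_at[OF d] by (simp add: differential_def tangent_spaceD(1)[OF w])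
qed

lemma unlift_component:
  assumes V: "V \<in> tangent_space (field_image \<xi> F) (\<xi> p)" and d: "d \<in> charts_at F p"
  shows "snd (unlift V) d = snd V (image_chart \<xi> d)"
proof -
  note dF = F.charts_atD[OF d]
  have p: "snd (image_chart \<xi> d) (\<xi> p) = snd d p"
    using dF by (simp add: image_chart_apply)
  have "((\<lambda>y. y) has_derivative (\<lambda>y. y)) (at (snd d p))"
    by (rule has_derivative_ident)
  then have *: "((snd d \<circ> fst) \<circ> chart_inv (image_chart \<xi> d) has_derivative (\<lambda>y. y)) (at (snd d p))"
    by (rule has_derivative_transform_within_open[OF _ F.open_chart[OF dF(1)] F.chart_in[OF d]])
      (use dF in \<open>auto simp: F.chart_inv_chart fst_section' chart_inv_image_chart\<close>)
  then have "dir_deriv (field_image \<xi> F) (snd d \<circ> fst) V = snd V (image_chart \<xi> d)"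
    using I.dir_deriv_chart[OF V image_chart_at[OF d], of "snd d \<circ> fst"] D_eqI[OF *]
    by (auto simp: differentiable_def p)
  then show ?thesis
    using d by (simp add: differential_def tangent_spaceD(1)[OF V] fst_section charts_at_pts)
qed

lemma D_image_transition:
  assumes d: "d \<in> charts_at F p" "d' \<in> charts_at F p"
  shows "D (snd (image_chart \<xi> d') \<circ> chart_inv (image_chart \<xi> d)) (snd (image_chart \<xi> d) (\<xi> p)) =
    D (snd d' \<circ> chart_inv d) (snd d p)"
proof -
  note dF = F.charts_atD[OF d(1)] F.charts_atD[OF d(2)]
  have "snd (image_chart \<xi> d) (\<xi> p) = snd d p"
    using dF by (simp add: image_chart_apply)
  then show ?thesis
    by (simp only:) (rule D_cong[OF F.open_overlap[OF dF(1,3)] F.in_overlap[OF d] image_transition[OF dF(1,3)]])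
qed

lemma lift_in_tangent_space:
  assumes w: "w \<in> tangent_space F p" and p: "p \<in> pts F"
  shows "lift w \<in> tangent_space (field_image \<xi> F) (\<xi> p)"
proof -
  have "fst (lift w) = \<xi> p"
    by (simp add: differential_def tangent_spaceD(1)[OF w])
  moreover have "snd (lift w) e = 0" if "e \<notin> charts_at (field_image \<xi> F) (\<xi> p)" for e
    using that by (simp add: differential_def tangent_spaceD(1)[OF w])
  moreover have "snd (lift w) e' = D (snd e' \<circ> chart_inv e) (snd e (\<xi> p)) (snd (lift w) e)"
    if e: "e \<in> charts_at (field_image \<xi> F) (\<xi> p)" "e' \<in> charts_at (field_image \<xi> F) (\<xi> p)" for e e'
  proof -
    obtain d d' where d: "d \<in> charts_at F p" "d' \<in> charts_at F p" "e = image_chart \<xi> d" "e' = image_chart \<xi> d'"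
      using e unfolding charts_at_field_image[OF p] by blast
    show ?thesis
      unfolding d(3,4) lift_component[OF w d(1)] lift_component[OF w d(2)] D_image_transition[OF d(1,2)]
      by (rule tangent_spaceD(2)[OF w d(1,2)])
  qed
  ultimately show ?thesis
    unfolding tangent_space_def by blast
qed

lemma unlift_in_tangent_space:
  assumes V: "V \<in> tangent_space (field_image \<xi> F) (\<xi> p)" and p: "p \<in> pts F"
  shows "unlift V \<in> tangent_space F p"
proof -
  have f: "fst (fst V) = p"
    using tangent_spaceD(1)[OF V] fst_section[OF p] by simp
  then have "fst (unlift V) = p"
    by (simp add: differential_def)
  moreover have "snd (unlift V) d = 0" if "d \<notin> charts_at F p" for d
    using that by (simp add: differential_def f)
  moreover have "snd (unlift V) d' = D (snd d' \<circ> chart_inv d) (snd d p) (snd (unlift V) d)"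
    if d: "d \<in> charts_at F p" "d' \<in> charts_at F p" for d d'
    unfolding unlift_component[OF V d(1)] unlift_component[OF V d(2)] D_image_transition[OF d, symmetric]
    by (rule tangent_spaceD(2)[OF V image_chart_at[OF d(1)] image_chart_at[OF d(2)]])
  ultimately show ?thesis
    unfolding tangent_space_def by blast
qed

lemma lift_unlift:
  assumes V: "V \<in> tangent_space (field_image \<xi> F) (\<xi> p)" and p: "p \<in> pts F"
  shows "lift (unlift V) = V"
proof (rule prod_eqI)
  note u = unlift_in_tangent_space[OF V p]
  note l = lift_in_tangent_space[OF u p]
  show "fst (lift (unlift V)) = fst V"
    using tangent_spaceD(1)[OF l] tangent_spaceD(1)[OF V] by simp
  show "snd (lift (unlift V)) = snd V"
  proof
    fix e
    show "snd (lift (unlift V)) e = snd V e"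
    proof (cases "e \<in> charts_at (field_image \<xi> F) (\<xi> p)")
      case True
      then obtain d where d: "d \<in> charts_at F p" "e = image_chart \<xi> d"
        using p by (auto simp: charts_at_field_image)
      then show ?thesis
        by (simp add: lift_component[OF u] unlift_component[OF V])
    next
      case False
      then show ?thesis
        using tangent_spaceD(3)[OF l] tangent_spaceD(3)[OF V] by simp
    qed
  qed
qed

lemma lift_tangent_space:
  assumes p: "p \<in> pts F"
  shows "tangent_space (field_image \<xi> F) (\<xi> p) = lift ` tangent_space F p"
proof (intro equalityI subsetI)
  fix V assume V: "V \<in> tangent_space (field_image \<xi> F) (\<xi> p)"
  show "V \<in> lift ` tangent_space F p"
    by (intro image_eqI[where x = "unlift V"] unlift_in_tangent_space[OF V p])
      (simp add: lift_unlift[OF V p])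
qed (use lift_in_tangent_space[OF _ p] in blast)

text \<open>In corresponding charts the lifted field has the coordinate expression of
  \<open>X\<close>, so smoothness carries over. With the converse below, tangent fields of the image
  are those of \<open>F\<close>.\<close>

lemma tangent_field_lift:
  assumes X: "tangent_field F X"
  shows "tangent_field (field_image \<xi> F) (\<lambda>v. lift (X (fst v)))"
proof -
  have X1: "X p \<in> tangent_space F p" if "p \<in> pts F" for p
    by (rule vector_field_along_in_tangent_space[OF X that])
  have X2: "smooth_on (snd c ` (fst c \<inter> fst c')) (\<lambda>x. snd (induced_chart F c') (X (chart_inv c x)))"
    if "c \<in> F" "c' \<in> F" for c c'
    using X that unfolding vector_field_along_iff[OF order_refl] by blast
  show ?thesis
    unfolding vector_field_along_iff[OF order_refl] pts_field_image
  proof (intro conjI ballI)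
    fix v assume "v \<in> \<xi> ` pts F"
    then show "lift (X (fst v)) \<in> tangent_space (field_image \<xi> F) v"
      using X1 by (auto simp: fst_section lift_in_tangent_space)
  next
    fix e e' assume e: "e \<in> field_image \<xi> F" "e' \<in> field_image \<xi> F"
    then obtain d d' where d: "d \<in> F" "d' \<in> F" "e = image_chart \<xi> d" "e' = image_chart \<xi> d'"
      by (auto simp: field_image_eq)
    show "open (snd e ` (fst e \<inter> fst e'))"
      by (rule I.open_overlap[OF e])
    have *: "snd (induced_chart (field_image \<xi> F) (image_chart \<xi> d')) (lift (X (fst (chart_inv (image_chart \<xi> d) y)))) =
        snd (induced_chart F d') (X (chart_inv d y))" if "y \<in> snd d ` (fst d \<inter> fst d')" for y
    proof -
      define q where "q = chart_inv d y"
      have q: "q \<in> fst d" "q \<in> fst d'" "y \<in> snd d ` fst d"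
        using that d(1) by (auto simp: q_def F.chart_inv_chart)
      then have d': "d' \<in> charts_at F q" and qF: "q \<in> pts F"
        using d by (auto simp: charts_at_def pts_def)
      note t = X1[OF qF]
      show ?thesis
        using q d lift_component[OF t d'] tangent_spaceD(1)[OF t]
          tangent_spaceD(1)[OF lift_in_tangent_space[OF t qF]] fst_section[OF qF]
        by (simp add: induced_chart_apply chart_inv_image_chart image_chart_apply flip: q_def)
    qed
    show "smooth_on (snd e ` (fst e \<inter> fst e'))
        (\<lambda>x. snd (induced_chart (field_image \<xi> F) e') (lift (X (fst (chart_inv e x)))))"
      unfolding d(3,4) image_chart_overlap[OF d(1,2)]
      by (rule smooth_on_transform[OF X2[OF d(1,2)] F.open_overlap[OF d(1,2)]]) (rule *)
  qed
qed

lemma tangent_field_unlift: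
  assumes X: "tangent_field (field_image \<xi> F) X"
  shows "tangent_field F (\<lambda>p. unlift (X (\<xi> p)))"
proof -
  have X1: "X (\<xi> p) \<in> tangent_space (field_image \<xi> F) (\<xi> p)" if "p \<in> pts F" for p
    using that by (intro vector_field_along_in_tangent_space[OF X]) (simp add: pts_field_image)
  have X2: "smooth_on (snd c ` (fst c \<inter> fst c')) (\<lambda>x. snd (induced_chart (field_image \<xi> F) c') (X (chart_inv c x)))"
    if "c \<in> field_image \<xi> F" "c' \<in> field_image \<xi> F" for c c'
    using X that unfolding vector_field_along_iff[OF order_refl] by blast
  show ?thesis
    unfolding vector_field_along_iff[OF order_refl]
  proof (intro conjI ballI)
    show "unlift (X (\<xi> p)) \<in> tangent_space F p" if "p \<in> pts F" for p
      by (rule unlift_in_tangent_space[OF X1[OF that] that])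
    fix d d' assume d: "d \<in> F" "d' \<in> F"
    show "open (snd d ` (fst d \<inter> fst d'))"
      by (rule F.open_overlap[OF d])
    have *: "snd (induced_chart (field_image \<xi> F) (image_chart \<xi> d')) (X (chart_inv (image_chart \<xi> d) y)) =
        snd (induced_chart F d') (unlift (X (\<xi> (chart_inv d y))))" if "y \<in> snd d ` (fst d \<inter> fst d')" for y
    proof -
      define q where "q = chart_inv d y"
      have q: "q \<in> fst d" "q \<in> fst d'" "y \<in> snd d ` fst d"
        using that d(1) by (auto simp: q_def F.chart_inv_chart)
      then have d': "d' \<in> charts_at F q" and qF: "q \<in> pts F"
        using d by (auto simp: charts_at_def pts_def)
      note t = X1[OF qF]
      show ?thesis
        using q d unlift_component[OF t d'] tangent_spaceD(1)[OF t]
          tangent_spaceD(1)[OF unlift_in_tangent_space[OF t qF]]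
        by (simp add: induced_chart_apply chart_inv_image_chart image_chart_apply flip: q_def)
    qed
    have "smooth_on (snd d ` (fst d \<inter> fst d'))
        (\<lambda>x. snd (induced_chart (field_image \<xi> F) (image_chart \<xi> d')) (X (chart_inv (image_chart \<xi> d) x)))"
      using X2[of "image_chart \<xi> d" "image_chart \<xi> d'"] d
      by (simp add: field_image_eq image_chart_overlap)
    then show "smooth_on (snd d ` (fst d \<inter> fst d'))
        (\<lambda>x. snd (induced_chart F d') (unlift (X (\<xi> (chart_inv d x)))))"
      by (rule smooth_on_transform[OF _ F.open_overlap[OF d]]) (simp add: *)
  qed
qed

end

section \<open>The second fundamental form of the image of a vector field\<close>

locale field_along = riemannian M g
  for M :: "('a, 'e::euclidean_space) atlas" and g :: "('a, 'e) metric" +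
  fixes F :: "('a, 'd::euclidean_space) atlas" and \<xi> :: "'a \<Rightarrow> ('a, 'e) tvec"
  assumes submanifold: "submanifold F M"
    and field: "vector_field_along M F \<xi>"

lemma (in field_along) section_atlas: "section_atlas F \<xi>"
  using submanifold field
  by (simp add: section_atlas_def section_atlas_axioms_def submanifold_def vector_field_along_def
      smooth_manifold_smooth_atlas)

sublocale field_along \<subseteq> section_atlas F \<xi>
  by (rule section_atlas)

context field_along begin

lemma pts_subset: "pts F \<subseteq> pts M"
  using submanifold by (simp add: submanifold_def smooth_map_def)

lemma field_in_tangent_space: "p \<in> pts F \<Longrightarrow> \<xi> p \<in> tangent_space M p"
  by (rule vector_field_along_in_tangent_space[OF field])

end

text \<open>One chart of \<open>M\<close> and one of \<open>F\<close> around a point. Here \<phi> is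
  the inclusion and \<open>s\<close> the field \<xi> in coordinates, both as functions on the
  overlap \<open>T\<close>.\<close>

locale field_along_chart = field_along M g F \<xi>
  for M :: "('a, 'e::euclidean_space) atlas" and g :: "('a, 'e) metric"
    and F :: "('a, 'd::euclidean_space) atlas" and \<xi> :: "'a \<Rightarrow> ('a, 'e) tvec" +
  fixes p :: 'a and c :: "('a, 'e) chart" and d :: "('a, 'd) chart"
  assumes c: "c \<in> charts_at M p" and d: "d \<in> charts_at F p"

sublocale field_along_chart \<subseteq> C: coordinate_metric "snd c ` fst c" "chart_metric M g c"
  by (rule coordinate_metric_chart[OF charts_atD(1)[OF c]])

context field_along_chart begin

abbreviation "T \<equiv> snd d ` (fst d \<inter> fst c)"
abbreviation "\<phi> y \<equiv> snd c (chart_inv d y)"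
abbreviation "s y \<equiv> snd (\<xi> (chart_inv d y)) c"
abbreviation "local_rep X y \<equiv> snd (X (chart_inv d y)) d"
abbreviation "y0 \<equiv> snd d p"
abbreviation "x0 \<equiv> snd c p"
abbreviation "s0 \<equiv> snd (\<xi> p) c"

lemmas cM = charts_atD[OF c]
lemmas dF = F.charts_atD[OF d]

lemma y0_in: "y0 \<in> T"
  using cM dF by simp

lemma x0_in: "x0 \<in> snd c ` fst c"
  using cM by simp

lemma at_y0 [simp]: "chart_inv d y0 = p"
  using dF by (simp add: F.chart_inv_chart)

lemma T_cases:
  assumes "y \<in> T"
  obtains q where "q \<in> fst d" "q \<in> fst c" "y = snd d q" "chart_inv d y = q" "q \<in> pts F"
    "d \<in> charts_at F q" "c \<in> charts_at M q"
  using assms cM dF by (auto simp: F.chart_inv_chart pts_def charts_at_def)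

text \<open>All three are read off from the smoothness of \<xi> as a map into the tangent bundle,
  whose coordinate expression is \<open>(\<phi> y, s y)\<close>.\<close>

lemma open_T: "open T" and smooth_\<phi>: "smooth_on T \<phi>" and smooth_s: "smooth_on T s"
proof -
  have *: "open T" "smooth_on T (\<lambda>x. snd (induced_chart M c) (\<xi> (chart_inv d x)))"
    using field cM(1) dF(1) unfolding vector_field_along_iff[OF pts_subset] by blast+
  show "open T" by (rule *(1))
  have "snd (induced_chart M c) (\<xi> (chart_inv d y)) = (\<phi> y, s y)" if "y \<in> T" for y
    using that by (rule T_cases) (simp add: induced_chart_apply fst_section)
  then have "smooth_on T (\<lambda>y. (\<phi> y, s y))"
    using *(2) smooth_on_cong[OF *(1), of "\<lambda>x. snd (induced_chart M c) (\<xi> (chart_inv d x))" "\<lambda>y. (\<phi> y, s y)"]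
    by simp
  from smooth_on_bounded_linear[OF *(1) bounded_linear_fst this]
    smooth_on_bounded_linear[OF *(1) bounded_linear_snd this]
  show "smooth_on T \<phi>" "smooth_on T s"
    by simp_all
qed

lemma dir_deriv_local:
  assumes w: "w \<in> tangent_space F p" and f: "(f has_derivative f') (at y0)"
    and eq: "\<And>y. y \<in> T \<Longrightarrow> f y = h (chart_inv d y)"
  shows "dir_deriv F h w = f' (snd w d)"
proof -
  have *: "(h \<circ> chart_inv d has_derivative f') (at y0)"
    by (rule has_derivative_transform_within_open[OF f open_T y0_in]) (simp add: eq)
  then show ?thesis
    using F.dir_deriv_chart[OF w d, of h] D_eqI[OF *] by (auto simp: differentiable_def)
qed

lemma dir_deriv_image_local:
  assumes w: "w \<in> tangent_space F p" and f: "(f has_derivative f') (at y0)"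
    and eq: "\<And>y. y \<in> T \<Longrightarrow> f y = h (\<xi> (chart_inv d y))"
  shows "dir_deriv (field_image \<xi> F) h (lift w) = f' (snd w d)"
proof -
  have y0: "snd (image_chart \<xi> d) (\<xi> p) = y0"
    using dF by (simp add: image_chart_apply)
  have *: "(h \<circ> chart_inv (image_chart \<xi> d) has_derivative f') (at y0)"
    by (rule has_derivative_transform_within_open[OF f open_T y0_in])
      (use dF in \<open>auto simp: eq chart_inv_image_chart\<close>)
  show ?thesis
    using I.dir_deriv_chart[OF lift_in_tangent_space[OF w charts_at_pts[OF d]] image_chart_at[OF d], of h]
      * D_eqI[OF *] lift_component[OF w d] by (auto simp: differentiable_def y0)
qed

lemma has_derivative_local_rep:
  assumes X: "tangent_field F X"
  shows "(local_rep X has_derivative D (local_rep X) y0) (at y0)"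
proof -
  have sm: "smooth_on (snd d ` fst d) (\<lambda>x. snd (induced_chart F d) (X (chart_inv d x)))"
    using X dF(1) unfolding vector_field_along_iff[OF order_refl] by (metis Int_absorb)
  have "smooth_on (snd d ` fst d) (local_rep X)"
    using smooth_on_bounded_linear[OF F.open_chart[OF dF(1)] bounded_linear_snd sm]
    by (simp add: induced_chart_apply)
  then show ?thesis
    using smooth_on_has_derivative F.chart_in[OF d] by blast
qed

lemma push_component:
  assumes "w \<in> tangent_space F p"
  shows "snd (push F M w) c = D \<phi> y0 (snd w d)"
proof -
  have "dir_deriv F (snd c \<circ> id) w = D \<phi> y0 (snd w d)"
    by (rule dir_deriv_local[OF assms smooth_on_has_derivative[OF smooth_\<phi> y0_in]]) simp
  then show ?thesis
    using c by (simp add: differential_def tangent_spaceD(1)[OF assms])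
qed

lemma push_lift_component:
  assumes "w \<in> tangent_space F p"
  shows "snd (push (field_image \<xi> F) (tangent_bundle M) (lift w)) (induced_chart M c) =
    (D \<phi> y0 (snd w d), D s y0 (snd w d))"
proof -
  have p: "p \<in> pts F"
    by (rule charts_at_pts[OF d])
  have "dir_deriv (field_image \<xi> F) (snd (induced_chart M c) \<circ> id) (lift w) =
      (D \<phi> y0 (snd w d), D s y0 (snd w d))"
  proof (rule dir_deriv_image_local[OF assms])
    show "((\<lambda>y. (\<phi> y, s y)) has_derivative (\<lambda>u. (D \<phi> y0 u, D s y0 u))) (at y0)"
      by (intro has_derivative_Pair smooth_on_has_derivative[OF smooth_\<phi> y0_in]
          smooth_on_has_derivative[OF smooth_s y0_in])
    show "(\<phi> y, s y) = (snd (induced_chart M c) \<circ> id) (\<xi> (chart_inv d y))" if "y \<in> T" for y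
      using that by (rule T_cases) (simp add: induced_chart_apply fst_section)
  qed
  then show ?thesis
    using c tangent_spaceD(1)[OF lift_in_tangent_space[OF assms p]]
    by (simp add: differential_def[of _ "tangent_bundle M"] charts_at_tangent_bundle[OF field_in_tangent_space[OF p]])
qed

text \<open>The argument of \<open>C.vertical\<close> consists of the components of the differential
  of \<xi> on \<open>w\<close>, by \<open>push_lift_component\<close>: the connection map sends that
  vector to the covariant derivative of \<xi>.\<close>

lemma cov_deriv_field_component:
  assumes w: "w \<in> tangent_space F p"
  shows "snd (cov_deriv M g F w \<xi>) c = C.vertical (x0, s0) (D \<phi> y0 (snd w d), D s y0 (snd w d))"
proof -
  have "dir_deriv F (\<lambda>q. snd (\<xi> q) c) w = D s y0 (snd w d)"
    by (rule dir_deriv_local[OF w smooth_on_has_derivative[OF smooth_s y0_in]]) simp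
  then show ?thesis
    using c by (simp add: cov_deriv_def Let_def tangent_spaceD(1)[OF w] push_component[OF w]
        C.vertical_def christoffel_eq_christoffel_form)
qed

text \<open>Differentiating at \<open>p\<close> involves values at nearby points; the same two
  charts are reused there.\<close>

lemma field_along_chart_at:
  "d \<in> charts_at F q \<Longrightarrow> c \<in> charts_at M q \<Longrightarrow> field_along_chart M g F \<xi> q c d"
  by unfold_locales

lemma has_derivative_D_family:
  fixes f :: "'d \<Rightarrow> 'b::euclidean_space"
  assumes f: "smooth_on T f" and Y: "(Y has_derivative Y') (at y0)"
  shows "((\<lambda>y. D f y (Y y)) has_derivative (\<lambda>u. D (\<lambda>y. D f y (Y y0)) y0 u + D f y0 (Y' u))) (at y0)"
proof (rule has_derivative_linear_family[OF _ _ Y])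
  show "\<forall>\<^sub>F y in nhds y0. linear (D f y)"
    unfolding eventually_nhds using open_T y0_in smooth_on_linear[OF f] by blast
  show "(\<lambda>y. D f y u) differentiable (at y0)" for u
    by (rule smooth_on_differentiable[OF smooth_on_D[OF f] y0_in])
qed

section \<open>Components of the covariant derivatives in a fixed pair of charts\<close>

context
  fixes X Y :: "'a \<Rightarrow> ('a, 'd) tvec"
  assumes X: "tangent_field F X" and Y: "tangent_field F Y"
begin

lemma p_in: "p \<in> pts F"
  by (rule charts_at_pts[OF d])

lemmas Xp = vector_field_along_in_tangent_space[OF X p_in]

lemmas Yp = vector_field_along_in_tangent_space[OF Y p_in]

abbreviation "dX \<equiv> (D \<phi> y0 (snd (X p) d), D s y0 (snd (X p) d))"
abbreviation "dY \<equiv> (D \<phi> y0 (snd (Y p) d), D s y0 (snd (Y p) d))"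

text \<open>\<open>(P, Q)\<close> is the derivative, in direction \<open>X\<close>, of the components of \<open>\<xi>\<^sub>* Y\<close> in the induced chart.\<close>

abbreviation "P \<equiv> D (\<lambda>y. D \<phi> y (local_rep Y y)) y0 (snd (X p) d)"
abbreviation "Q \<equiv> D (\<lambda>y. D s y (local_rep Y y)) y0 (snd (X p) d)"

lemma has_derivative_push_Y:
  "((\<lambda>y. D \<phi> y (local_rep Y y)) has_derivative D (\<lambda>y. D \<phi> y (local_rep Y y)) y0) (at y0)"
  "((\<lambda>y. D s y (local_rep Y y)) has_derivative D (\<lambda>y. D s y (local_rep Y y)) y0) (at y0)"
  using has_derivative_D_family[OF smooth_\<phi> has_derivative_local_rep[OF Y]]
    has_derivative_D_family[OF smooth_s has_derivative_local_rep[OF Y]]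
  by (simp_all add: D_eqI)

lemma push_Y:
  assumes "y \<in> T"
  shows "snd (push F M (Y (chart_inv d y))) c = D \<phi> y (local_rep Y y)"
  using assms
proof (rule T_cases)
  fix q assume q: "q \<in> pts F" "d \<in> charts_at F q" "c \<in> charts_at M q" "chart_inv d y = q" "y = snd d q"
  interpret q: field_along_chart M g F \<xi> q c d
    by (rule field_along_chart_at[OF q(2,3)])
  show ?thesis
    using q.push_component[OF vector_field_along_in_tangent_space[OF Y q(1)]] q by simp
qed

lemma lc_connection_component:
  "snd (lc_connection M g F X Y p) c = P + C.\<Gamma> x0 (fst dX) (fst dY)"
proof -
  have "dir_deriv F (\<lambda>q. snd (push F M (Y q)) c) (X p) = P"
    by (rule dir_deriv_local[OF Xp has_derivative_push_Y(1)]) (simp add: push_Y)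
  then show ?thesis
    using c by (simp add: lc_connection_def cov_deriv_def Let_def tangent_spaceD(1)[OF Xp]
        push_component Xp Yp christoffel_eq_christoffel_form)
qed

lemma curvature_component:
  "fst u = p \<Longrightarrow> snd (curvature M g u v w) c = C.R x0 (snd u c) (snd v c) (snd w c)"
  using c by (simp add: curvature_def Let_def christoffel_eq_christoffel_form)

lemma fst_\<xi>_p: "fst (\<xi> p) = p"
  by (rule fst_section[OF p_in])

text \<open>The covariant derivatives of \<xi> in the curvature terms are \<open>C.vertical\<close>
  of \<open>dX\<close> and \<open>dY\<close>, so together with the \<Gamma> term of
  \<open>lc_connection\<close> they form \<open>C.sasaki_horizontal\<close>.\<close>

lemma xi_connection_component:
  "snd (xi_connection M g F \<xi> X Y p) c = P + C.sasaki_horizontal (x0, s0) dX dY"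
  by (simp add: xi_connection_def tadd_def tscale_def lc_connection_component
      curvature_component[OF fst_\<xi>_p] cov_deriv_field_component[OF Xp] cov_deriv_field_component[OF Yp]
      push_component[OF Xp] push_component[OF Yp] C.sasaki_horizontal_def)

text \<open>\<open>X'\<close> enters only through its value at the point, whereas \<open>Y'\<close>
  is differentiated and so must be the lift of \<open>Y\<close> at every point of the image.\<close>

lemma sasaki_connection_component:
  assumes X': "X' (\<xi> p) = lift (X p)" and Y': "\<And>q. q \<in> pts F \<Longrightarrow> Y' (\<xi> q) = lift (Y q)"
  shows "snd (lc_connection (tangent_bundle M) (sasaki_metric M g) (field_image \<xi> F) X' Y' (\<xi> p))
      (induced_chart M c) = (P, Q) + C.sasaki_\<Gamma> (x0, s0) dX dY"
proof -
  let ?I = "field_image \<xi> F"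
  have "dir_deriv ?I (\<lambda>v. snd (push ?I (tangent_bundle M) (Y' v)) (induced_chart M c)) (lift (X p)) = (P, Q)"
  proof (rule dir_deriv_image_local[OF Xp has_derivative_Pair[OF has_derivative_push_Y]])
    fix y assume "y \<in> T"
    then show "(D \<phi> y (local_rep Y y), D s y (local_rep Y y)) =
        snd (push ?I (tangent_bundle M) (Y' (\<xi> (chart_inv d y)))) (induced_chart M c)"
    proof (rule T_cases)
      fix q assume q: "q \<in> pts F" "d \<in> charts_at F q" "c \<in> charts_at M q" "chart_inv d y = q" "y = snd d q"
      interpret q: field_along_chart M g F \<xi> q c d
        by (rule field_along_chart_at[OF q(2,3)])
      show ?thesis
        using q.push_lift_component[OF vector_field_along_in_tangent_space[OF Y q(1)]] q by (simp add: Y')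
    qed
  qed
  moreover have "induced_chart M c \<in> charts_at (tangent_bundle M) (\<xi> p)"
    using c by (simp add: charts_at_tangent_bundle[OF field_in_tangent_space[OF p_in]])
  moreover have "snd (induced_chart M c) (\<xi> p) = (x0, s0)"
    by (simp add: induced_chart_apply fst_\<xi>_p)
  ultimately show ?thesis
    using tangent_spaceD(1)[OF lift_in_tangent_space[OF Xp p_in]]
    by (simp add: lc_connection_def cov_deriv_def Let_def X' Y' p_in push_lift_component Xp Yp
        christoffel_sasaki[OF cM(1) x0_in])
qed

text \<open>\<open>Q + C.\<Gamma> x0 P s0\<close> is the connection map of \<open>(P, Q)\<close>.
  The half curvature undoes the one subtracted in \<open>C.sasaki_vertical\<close>; it becomes the
  curvature term of condition (b).\<close>

lemma second_cov_deriv_component: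
  "snd (cov_deriv M g F (X p) (\<lambda>q. cov_deriv M g F (Y q) \<xi>)) c =
    Q + C.\<Gamma> x0 P s0 + C.sasaki_vertical (x0, s0) dX dY + (1/2) *\<^sub>R C.R x0 (fst dX) (fst dY) s0"
proof -
  have "((\<lambda>y. D s y (local_rep Y y) + C.\<Gamma> (\<phi> y) (D \<phi> y (local_rep Y y)) (s y)) has_derivative
      (\<lambda>u. D (\<lambda>y. D s y (local_rep Y y)) y0 u + (D (\<lambda>y. C.\<Gamma> y (D \<phi> y0 (local_rep Y y0)) (s y0)) (\<phi> y0) (D \<phi> y0 u)
        + C.\<Gamma> (\<phi> y0) (D (\<lambda>y. D \<phi> y (local_rep Y y)) y0 u) (s y0)
        + C.\<Gamma> (\<phi> y0) (D \<phi> y0 (local_rep Y y0)) (D s y0 u)))) (at y0)"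
    by (intro has_derivative_add has_derivative_push_Y
        has_derivative_bilinear_family[where \<phi> = \<phi> and x = y0, OF C.open_S _ C.bilinear_\<Gamma> C.differentiable_\<Gamma>]
        smooth_on_has_derivative[OF smooth_\<phi> y0_in] smooth_on_has_derivative[OF smooth_s y0_in])
      (simp_all add: x0_in)
  then have "dir_deriv F (\<lambda>q. snd (cov_deriv M g F (Y q) \<xi>) c) (X p) =
      D (\<lambda>y. D s y (local_rep Y y)) y0 (snd (X p) d) + (D (\<lambda>y. C.\<Gamma> y (D \<phi> y0 (local_rep Y y0)) (s y0)) (\<phi> y0) (D \<phi> y0 (snd (X p) d))
        + C.\<Gamma> (\<phi> y0) (D (\<lambda>y. D \<phi> y (local_rep Y y)) y0 (snd (X p) d)) (s y0)
        + C.\<Gamma> (\<phi> y0) (D \<phi> y0 (local_rep Y y0)) (D s y0 (snd (X p) d)))"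
  proof (rule dir_deriv_local[OF Xp])
    fix y assume "y \<in> T"
    then show "D s y (local_rep Y y) + C.\<Gamma> (\<phi> y) (D \<phi> y (local_rep Y y)) (s y) =
        snd (cov_deriv M g F (Y (chart_inv d y)) \<xi>) c"
    proof (rule T_cases)
      fix q assume q: "q \<in> pts F" "d \<in> charts_at F q" "c \<in> charts_at M q" "chart_inv d y = q" "y = snd d q"
      interpret q: field_along_chart M g F \<xi> q c d
        by (rule field_along_chart_at[OF q(2,3)])
      show ?thesis
        using q.cov_deriv_field_component[OF vector_field_along_in_tangent_space[OF Y q(1)]] q
        by (simp add: C.vertical_def)
    qed
  qed
  then show ?thesis
    using c by (simp add: cov_deriv_def[of _ _ _ "X p"] Let_def tangent_spaceD(1)[OF Xp]
        push_component[OF Xp] cov_deriv_field_component[OF Yp] christoffel_eq_christoffel_form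
        C.sasaki_vertical_def)
qed

lemma sasaki_connection_component_eq_iff:
  assumes X': "X' (\<xi> p) = lift (X p)" and Y': "\<And>q. q \<in> pts F \<Longrightarrow> Y' (\<xi> q) = lift (Y q)"
    and w: "w \<in> tangent_space F p"
  shows "snd (lc_connection (tangent_bundle M) (sasaki_metric M g) (field_image \<xi> F) X' Y' (\<xi> p))
      (induced_chart M c) = snd (push (field_image \<xi> F) (tangent_bundle M) (lift w)) (induced_chart M c) \<longleftrightarrow>
    snd (xi_connection M g F \<xi> X Y p) c = snd (push F M w) c \<and>
    snd (cov_deriv M g F (X p) (\<lambda>q. cov_deriv M g F (Y q) \<xi>)) c =
      snd (tadd (cov_deriv M g F w \<xi>) (tscale (1/2) (curvature M g (push F M (X p)) (push F M (Y p)) (\<xi> p)))) c"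
proof -
  have f: "fst (push F M (X p)) = p"
    by (simp add: differential_def tangent_spaceD(1)[OF Xp])
  let ?p = "(x0, s0)" and ?W = "(D \<phi> y0 (snd w d), D s y0 (snd w d))"
  \<comment> \<open>A vector of the tangent bundle is determined by its first component and its
    image under the connection map; this splits one equation into two.\<close>
  have "(P, Q) + C.sasaki_\<Gamma> ?p dX dY = ?W \<longleftrightarrow>
      fst ((P, Q) + C.sasaki_\<Gamma> ?p dX dY) = fst ?W \<and>
      C.vertical ?p ((P, Q) + C.sasaki_\<Gamma> ?p dX dY) = C.vertical ?p ?W"
    by (auto simp: prod_eq_iff C.vertical_def)
  moreover have "fst ((P, Q) + C.sasaki_\<Gamma> ?p dX dY) = P + C.sasaki_horizontal ?p dX dY"
    by (simp add: C.sasaki_\<Gamma>_def)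
  moreover have "C.vertical ?p ((P, Q) + C.sasaki_\<Gamma> ?p dX dY) =
      Q + C.\<Gamma> x0 P s0 + C.sasaki_vertical ?p dX dY"
    using linear_add[OF C.linear_vertical, of ?p "(P, Q)"] x0_in
    by (simp add: C.vertical_sasaki_\<Gamma>) (simp add: C.vertical_def)
  moreover have "snd (lc_connection (tangent_bundle M) (sasaki_metric M g) (field_image \<xi> F) X' Y' (\<xi> p))
      (induced_chart M c) = (P, Q) + C.sasaki_\<Gamma> ?p dX dY"
    using X' Y' by (rule sasaki_connection_component)
  ultimately show ?thesis
    unfolding push_lift_component[OF w]
      xi_connection_component push_component[OF w] second_cov_deriv_component
    by (simp add: tadd_def tscale_def cov_deriv_field_component[OF w] curvature_component[OF f]
        push_component[OF Xp] push_component[OF Yp])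
qed

end

end

section \<open>Comparison over all charts, and the equivalence\<close>

lemma tvec_eq_iff:
  assumes "fst v = fst w" "\<And>c. c \<notin> C \<Longrightarrow> snd v c = snd w c"
  shows "v = w \<longleftrightarrow> (\<forall>c\<in>C. snd v c = snd w c)"
  using assms by (auto simp: prod_eq_iff fun_eq_iff)

context field_along begin

text \<open>A vector tangent to the image is \<open>push\<close> of \<open>lift w\<close>. For each
  such \<open>w\<close> the equivalence holds in every chart of \<open>M\<close> at
  \<open>p\<close>, and the induced charts are all the charts at \<open>\<xi> p\<close>; hence a
  single \<open>w\<close> serves all of them.\<close>

lemma tangent_connection_iff:
  assumes X: "tangent_field F X" and Y: "tangent_field F Y" and p: "p \<in> pts F"
    and X': "X' (\<xi> p) = lift (X p)" and Y': "\<And>q. q \<in> pts F \<Longrightarrow> Y' (\<xi> q) = lift (Y q)"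
  defines "E w \<equiv> tadd (cov_deriv M g F w \<xi>)
    (tscale (1/2) (curvature M g (push F M (X p)) (push F M (Y p)) (\<xi> p)))"
  shows "lc_connection (tangent_bundle M) (sasaki_metric M g) (field_image \<xi> F) X' Y' (\<xi> p)
      \<in> push (field_image \<xi> F) (tangent_bundle M) ` tangent_space (field_image \<xi> F) (\<xi> p) \<longleftrightarrow>
    (\<exists>w\<in>tangent_space F p. xi_connection M g F \<xi> X Y p = push F M w \<and>
      cov_deriv M g F (X p) (\<lambda>q. cov_deriv M g F (Y q) \<xi>) = E w)"
proof -
  let ?N = "lc_connection (tangent_bundle M) (sasaki_metric M g) (field_image \<xi> F) X' Y' (\<xi> p)"
  let ?Z = "cov_deriv M g F (X p) (\<lambda>q. cov_deriv M g F (Y q) \<xi>)"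
  obtain d where d: "d \<in> charts_at F p"
    using p by (auto simp: pts_def charts_at_def)
  have Xp: "fst (X p) = p"
    by (rule tangent_spaceD(1)[OF vector_field_along_in_tangent_space[OF X p]])
  have *: "?N = push (field_image \<xi> F) (tangent_bundle M) (lift w) \<longleftrightarrow>
      xi_connection M g F \<xi> X Y p = push F M w \<and> ?Z = E w" if w: "w \<in> tangent_space F p" for w
  proof -
    note wp = tangent_spaceD(1)[OF w]
    have lw: "fst (lift w) = \<xi> p"
      by (rule tangent_spaceD(1)[OF lift_in_tangent_space[OF w p]])
    have lX: "fst (lift (X p)) = \<xi> p"
      by (simp add: differential_def Xp)
    have 1: "?N = push (field_image \<xi> F) (tangent_bundle M) (lift w) \<longleftrightarrow>
        (\<forall>e\<in>charts_at (tangent_bundle M) (\<xi> p).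
          snd ?N e = snd (push (field_image \<xi> F) (tangent_bundle M) (lift w)) e)"
      by (rule tvec_eq_iff) (auto simp: lc_connection_def cov_deriv_def Let_def X' lX lw
          differential_def[of _ "tangent_bundle M"])
    have 2: "xi_connection M g F \<xi> X Y p = push F M w \<longleftrightarrow>
        (\<forall>c\<in>charts_at M p. snd (xi_connection M g F \<xi> X Y p) c = snd (push F M w) c)"
      by (rule tvec_eq_iff) (auto simp: xi_connection_def tadd_def tscale_def lc_connection_def
          cov_deriv_def curvature_def Let_def Xp wp differential_def fst_section[OF p])
    have 3: "?Z = E w \<longleftrightarrow> (\<forall>c\<in>charts_at M p. snd ?Z c = snd (E w) c)"
      by (rule tvec_eq_iff) (auto simp: E_def tadd_def tscale_def
          cov_deriv_def curvature_def Let_def Xp wp differential_def)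
    have "snd ?N (induced_chart M c) = snd (push (field_image \<xi> F) (tangent_bundle M) (lift w)) (induced_chart M c)
        \<longleftrightarrow> snd (xi_connection M g F \<xi> X Y p) c = snd (push F M w) c \<and> snd ?Z c = snd (E w) c"
      if "c \<in> charts_at M p" for c
    proof -
      interpret field_along_chart M g F \<xi> p c d
        by unfold_locales (rule that d)+
      show ?thesis
        unfolding E_def using X Y X' Y' w by (rule sasaki_connection_component_eq_iff)
    qed
    then show ?thesis
      unfolding 1 2 3 charts_at_tangent_bundle[OF field_in_tangent_space[OF p]] by auto
  qed
  show ?thesis
    unfolding lift_tangent_space[OF p] image_image image_iff by (rule bex_cong[OF refl *])
qed

lemma pull_push:
  assumes w: "w \<in> tangent_space F p" and p: "p \<in> pts F"
  shows "pull F M (push F M w) = w"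
proof -
  have "fst (push F M w) = p"
    by (simp add: differential_def tangent_spaceD(1)[OF w])
  moreover have "inj_on (push F M) (tangent_space F p)"
    using submanifold p by (simp add: submanifold_def)
  ultimately show ?thesis
    unfolding pull_def using w by (auto intro!: the_equality dest: inj_onD)
qed

lemma totally_geodesic_field_image_iff:
  "totally_geodesic (tangent_bundle M)
     (lc_connection (tangent_bundle M) (sasaki_metric M g) (field_image \<xi> F)) (field_image \<xi> F) \<longleftrightarrow>
   (\<forall>X Y. tangent_field F X \<and> tangent_field F Y \<longrightarrow> (\<forall>p\<in>pts F. \<exists>w\<in>tangent_space F p.
      xi_connection M g F \<xi> X Y p = push F M w \<and>
      cov_deriv M g F (X p) (\<lambda>q. cov_deriv M g F (Y q) \<xi>) = tadd (cov_deriv M g F w \<xi>)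
        (tscale (1/2) (curvature M g (push F M (X p)) (push F M (Y p)) (\<xi> p)))))"
  (is "?L \<longleftrightarrow> ?R")
proof
  assume L: ?L
  show ?R
  proof (intro allI impI ballI, elim conjE)
    fix X Y p assume X: "tangent_field F X" and Y: "tangent_field F Y" and p: "p \<in> pts F"
    \<comment> \<open>As \<open>fst\<close> inverts \<xi> on the image, these are the fields there
      that correspond to \<open>X\<close> and \<open>Y\<close>.\<close>
    let ?X = "\<lambda>v. lift (X (fst v))" and ?Y = "\<lambda>v. lift (Y (fst v))"
    have "\<xi> p \<in> pts (field_image \<xi> F)"
      using p by (simp add: pts_field_image)
    then have "lc_connection (tangent_bundle M) (sasaki_metric M g) (field_image \<xi> F) ?X ?Y (\<xi> p)
      \<in> push (field_image \<xi> F) (tangent_bundle M) ` tangent_space (field_image \<xi> F) (\<xi> p)"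
      using L tangent_field_lift[OF X] tangent_field_lift[OF Y] unfolding totally_geodesic_def by blast
    then show "\<exists>w\<in>tangent_space F p. xi_connection M g F \<xi> X Y p = push F M w \<and>
      cov_deriv M g F (X p) (\<lambda>q. cov_deriv M g F (Y q) \<xi>) = tadd (cov_deriv M g F w \<xi>)
        (tscale (1/2) (curvature M g (push F M (X p)) (push F M (Y p)) (\<xi> p)))"
      by (subst (asm) tangent_connection_iff[OF X Y p]) (simp_all add: fst_section p)
  qed
next
  assume R: ?R
  show ?L
    unfolding totally_geodesic_def
  proof (intro allI impI ballI, elim conjE)
    fix X Y v assume X: "tangent_field (field_image \<xi> F) X" and Y: "tangent_field (field_image \<xi> F) Y"
      and "v \<in> pts (field_image \<xi> F)"
    then obtain p where p: "p \<in> pts F" "v = \<xi> p"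
      by (auto simp: pts_field_image)
    \<comment> \<open>Every field on the image is the lift of its projection, so \<open>?R\<close>
      for the projected fields settles all fields on the image.\<close>
    have lift: "Z (\<xi> q) = lift (unlift (Z (\<xi> q)))" if "tangent_field (field_image \<xi> F) Z" "q \<in> pts F" for Z q
      using that lift_unlift[OF vector_field_along_in_tangent_space[OF that(1)], of q]
      by (simp add: pts_field_image)
    show "lc_connection (tangent_bundle M) (sasaki_metric M g) (field_image \<xi> F) X Y v
      \<in> push (field_image \<xi> F) (tangent_bundle M) ` tangent_space (field_image \<xi> F) v"
      unfolding p(2)
    proof (subst tangent_connection_iff)
      show "tangent_field F (\<lambda>p. unlift (X (\<xi> p)))" "tangent_field F (\<lambda>p. unlift (Y (\<xi> p)))"
        by (rule tangent_field_unlift[OF X], rule tangent_field_unlift[OF Y])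
    qed (use R tangent_field_unlift[OF X] tangent_field_unlift[OF Y] lift X Y p(1) in blast)+
  qed
qed

end

theorem proposition3p1:
  fixes M :: "('a, 'e::euclidean_space) atlas" and g :: "('a, 'e) metric"
    and F :: "('a, 'd::euclidean_space) atlas" and \<xi> :: "'a \<Rightarrow> ('a, 'e) tvec"
  assumes "riemannian_manifold M g"
    and "submanifold F M"
    and "vector_field_along M F \<xi>"
  shows
    "totally_geodesic (tangent_bundle M)
       (lc_connection (tangent_bundle M) (sasaki_metric M g) (field_image \<xi> F)) (field_image \<xi> F)
     \<longleftrightarrow>
     totally_geodesic M (xi_connection M g F \<xi>) F \<and>
     (\<forall>X Y. tangent_field F X \<and> tangent_field F Y \<longrightarrow>
        (\<forall>p\<in>pts F.
           cov_deriv M g F (X p) (\<lambda>q. cov_deriv M g F (Y q) \<xi>) =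
           tadd (cov_deriv M g F (pull F M (xi_connection M g F \<xi> X Y p)) \<xi>)
             (tscale (1/2) (curvature M g (push F M (X p)) (push F M (Y p)) (\<xi> p)))))"
proof -
  interpret field_along M g F \<xi>
    using assms by unfold_locales
  \<comment> \<open>Injectivity of \<open>push\<close> leaves \<open>pull F M v\<close> as the only
    candidate for \<open>w\<close>, which separates tangency (a) from the equation (b).\<close>
  have "(\<exists>w\<in>tangent_space F p. v = push F M w \<and> Q w) \<longleftrightarrow>
      v \<in> push F M ` tangent_space F p \<and> Q (pull F M v)" if "p \<in> pts F" for v p Q
    using pull_push[OF _ that] by auto
  note this[simp]
  show ?thesis
    unfolding totally_geodesic_field_image_iff totally_geodesic_def[of M] by (simp cong: ball_cong) blast
qed

end
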